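(* Let $G$ be a graph and $A\in\mathcal{S}(G)$. Let $\Psi$ be one of the following: Case 1, $\Psi=\Psi_S(A)$; Case 2, $\Psi=\Psi_M(A)$; Case 3, $\Psi=\Psi_A(A)$. Suppose $\mathbf{x}$ is a vector in the column space of $\Psi$ such that the complement of $\operatorname{supp}(\mathbf{x})$ corresponds to a linearly independent set of rows of $\Psi$. Let $H$ be the spanning subgraph of $\overline{G}$ whose edges correspond to $\operatorname{supp}(\mathbf{x})$. Then $A$ can be perturbed to a matrix $A'\in\mathcal{S}(G\cup H)$ such that: Case 1: $A'$ has the SSP and the same spectrum as $A$; Case 2: $A'$ has the SMP and the same ordered multiplicity list as $A$; Case 3: $A'$ has the SAP and the same rank as $A$.
   Context: All matrices are real. For a graph $G$ on vertices $\{1,\dots,n\}$, $\mathcal{S}(G)$ is the set of real symmetric $n\times n$ matrices $A=[a_{ij}]$ such that, for $i\neq j$, $a_{ij}\ne 0$ if and only if $ij$ is an edge of $G$ (diagonal entries are free). $\overline{G}$ is the complement of $G$; $G\cup H$ has the same vertex set and edge set $E(G)\cup E(H)$. The ordered multiplicity list of $A$ is $(m_1,\dots,m_q)$, where $m_i$ is the multiplicity of the $i$th smallest of the $q$ distinct eigenvalues of $A$. "$A$ can be perturbed to $A'$ with given properties" means that matrices $A'$ with these properties exist arbitrarily close to $A$. Let $\circ$ be the entrywise product and $[A,X]=AX-XA$. $A$ has the Strong Arnold Property (SAP) if the only symmetric $X$ with $A\circ X=O$, $I\circ X=O$, $AX=O$ is $X=O$. $A$ has the Strong Spectral Property (SSP)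 if the only symmetric $X$ with $A\circ X=O$, $I\circ X=O$, $[A,X]=O$ is $X=O$. An $n\times n$ matrix $A$ has the Strong Multiplicity Property (SMP) if the only symmetric $X$ with $A\circ X=O$, $I\circ X=O$, $[A,X]=O$ and $\operatorname{tr}(A^iX)=0$ for $i=2,\dots,n-1$ is $X=O$. Let $\overline{E}=\{(i,j): i<j,\ \{i,j\}\in E(\overline{G})\}$. For a symmetric $n\times n$ matrix $M$, let $\operatorname{vec}_{\overline{E}}(M)$ be the vector indexed by $\overline{E}$ (lexicographic order) with $(i,j)$-coordinate $M_{ij}$. $E_{ij}$ is the $n\times n$ matrix with a $1$ in position $(i,j)$ and zeros elsewhere, and $K_{ij}=E_{ij}-E_{ji}$. The verification matrices, whose rows are indexed by $\overline{E}$, are: $\Psi_S(A)$: the $|\overline{E}|\times\binom n2$ matrix with columns $\operatorname{vec}_{\overline{E}}(AK_{k\ell}+K_{\ell k}A)$, $1\le k<\ell\le n$; $\Psi_M(A)$: the $|\overline{E}|\times(\binom n2+q)$ matrix obtained from $\Psi_S(A)$ by adjoining the columns $\operatorname{vec}_{\overline{E}}(A^k)$, $k=0,\dots,q-1$, where $q$ is the number of distinct eigenvalues of $A$; $\Psi_A(A)$: the $|\overline{E}|\times n^2$ matrix with columns $\operatorname{vec}_{\overline{E}}(AE_{k\ell}+E_{\ell k}A)$, $1\le k,\ell\le n$. $\operatorname{supp}(\mathbf{x})\subseteq\overline{E}$ is the set of indices of the nonzero coordinates of $\mathbf{x}$. *)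

theory Defs
  imports "HOL-Analysis.Analysis"
begin

text \<open>
  Vertices are the elements of a finite linearly ordered type \<open>'n\<close>, standing for
  \<open>{1, \<dots>, n}\<close> with \<open>n = CARD('n)\<close>. A graph is given by its set of edges, each a two-element set
  of vertices.
\<close>

definition all_edges :: "'n set set" where
  "all_edges = {e. card e = 2}"

definition is_graph :: "'n set set \<Rightarrow> bool" where
  "is_graph G \<longleftrightarrow> G \<subseteq> all_edges"

definition graph_compl :: "'n set set \<Rightarrow> 'n set set" where
  "graph_compl G = all_edges - G"

definition sym_mat :: "real^'n^'n \<Rightarrow> bool" where
  "sym_mat A \<longleftrightarrow> transpose A = A"

definition mats_of_graph :: "'n set set \<Rightarrow> (real^'n^'n) set" where
  "mats_of_graph G =
     {A. sym_mat A \<and> (\<forall>i j. i \<noteq> j \<longrightarrow> (A $ i $ j \<noteq> 0 \<longleftrightarrow> {i, j} \<in> G))}"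


subsection \<open>Eigenvalues\<close>

definition eigvals :: "real^'n^'n \<Rightarrow> real set" where
  "eigvals A = {c. \<exists>v. v \<noteq> 0 \<and> A *v v = c *\<^sub>R v}"

text \<open>
  All notions below are used for symmetric matrices only; these have real eigenvalues, and
  geometric and algebraic multiplicities agree.
\<close>

definition eig_mult :: "real^'n^'n \<Rightarrow> real \<Rightarrow> nat" where
  "eig_mult A c = dim {v. A *v v = c *\<^sub>R v}"

definition spectrum :: "real^'n^'n \<Rightarrow> real multiset" where
  "spectrum A = (\<Sum>c\<in>eigvals A. replicate_mset (eig_mult A c) c)"

definition ordered_mult_list :: "real^'n^'n \<Rightarrow> nat list" where
  "ordered_mult_list A = map (eig_mult A) (sorted_list_of_set (eigvals A))"

text \<open>The sum and the list above are taken over a finite set:\<close>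

lemma finite_eigvals:
  fixes A :: "real^'n^'n"
  assumes "sym_mat A"
  shows "finite (eigvals A)"
proof -
  have "\<forall>c\<in>eigvals A. \<exists>v. v \<noteq> 0 \<and> A *v v = c *\<^sub>R v"
    by (simp add: eigvals_def)
  then obtain f where f: "\<And>c. c \<in> eigvals A \<Longrightarrow> f c \<noteq> 0 \<and> A *v f c = c *\<^sub>R f c"
    by metis
  have orth: "f c \<bullet> f d = 0" if c: "c \<in> eigvals A" and d: "d \<in> eigvals A" and ne: "c \<noteq> d" for c d
  proof -
    have "(A *v f c) \<bullet> f d = f c \<bullet> (A *v f d)"
      using assms unfolding sym_mat_def by (metis dot_lmul_matrix vector_transpose_matrix)
    then have "c * (f c \<bullet> f d) = d * (f c \<bullet> f d)"
      using f[OF c] f[OF d] by simp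
    then show ?thesis using ne by simp
  qed
  have "inj_on f (eigvals A)"
    using orth f by (metis inj_onI inner_eq_zero_iff)
  moreover have "independent (f ` eigvals A)"
    using orth f by (intro pairwise_orthogonal_independent) (auto simp: pairwise_def orthogonal_def)
  ultimately show ?thesis
    using independent_imp_finite finite_imageD by blast
qed


subsection \<open>Strong properties\<close>

definition hadamard :: "real^'n^'n \<Rightarrow> real^'n^'n \<Rightarrow> real^'n^'n" where
  "hadamard A X = (\<chi> i j. A $ i $ j * X $ i $ j)"

definition commutator :: "real^'n^'n \<Rightarrow> real^'n^'n \<Rightarrow> real^'n^'n" where
  "commutator A X = A ** X - X ** A"

text \<open>The library's product and power on \<open>real^'n^'n\<close> are entrywise, hence a separate power.\<close>

primrec mat_pow :: "real^'n^'n \<Rightarrow> nat \<Rightarrow> real^'n^'n" where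
  "mat_pow A 0 = mat 1"
| "mat_pow A (Suc k) = A ** mat_pow A k"

definition SAP :: "real^'n^'n \<Rightarrow> bool" where
  "SAP A \<longleftrightarrow> (\<forall>X. sym_mat X \<and> hadamard A X = 0 \<and> hadamard (mat 1) X = 0 \<and> A ** X = 0
                 \<longrightarrow> X = 0)"

definition SSP :: "real^'n^'n \<Rightarrow> bool" where
  "SSP A \<longleftrightarrow> (\<forall>X. sym_mat X \<and> hadamard A X = 0 \<and> hadamard (mat 1) X = 0 \<and> commutator A X = 0
                 \<longrightarrow> X = 0)"

definition SMP :: "real^'n^'n \<Rightarrow> bool" where
  "SMP A \<longleftrightarrow> (\<forall>X. sym_mat X \<and> hadamard A X = 0 \<and> hadamard (mat 1) X = 0 \<and> commutator A X = 0 \<and>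
                    (\<forall>i\<in>{2..CARD('n) - 1}. trace (mat_pow A i ** X) = 0)
                 \<longrightarrow> X = 0)"


subsection \<open>Matrices with prescribed index sets\<close>

text \<open>
  A matrix whose rows and columns are indexed by subsets of the types \<open>'r\<close> and \<open>'c\<close>; entries
  outside the index sets are irrelevant. A vector indexed by a subset of \<open>'r\<close> is represented
  in \<open>real^'r\<close>, extended by zero.
\<close>

record ('r, 'c) imat =
  row_ix :: "'r set"
  col_ix :: "'c set"
  entry :: "'r \<Rightarrow> 'c \<Rightarrow> real"

definition col_vec :: "('r::finite, 'c) imat \<Rightarrow> 'c \<Rightarrow> real^'r" where
  "col_vec M j = (\<chi> i. if i \<in> row_ix M then entry M i j else 0)"

definition column_space :: "('r::finite, 'c) imat \<Rightarrow> (real^'r) set" where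
  "column_space M = span (col_vec M ` col_ix M)"

text \<open>Independence of the rows in \<open>S\<close> as a family: two equal rows are dependent.\<close>

definition rows_independent :: "('r::finite, 'c) imat \<Rightarrow> 'r set \<Rightarrow> bool" where
  "rows_independent M S \<longleftrightarrow> S \<subseteq> row_ix M \<and>
     (\<forall>a. (\<forall>j\<in>col_ix M. (\<Sum>i\<in>S. a i * entry M i j) = 0) \<longrightarrow> (\<forall>i\<in>S. a i = 0))"

definition supp :: "real^'r \<Rightarrow> 'r set" where
  "supp x = {i. x $ i \<noteq> 0}"


subsection \<open>Verification matrices\<close>

definition Ebar :: "'n::linorder set set \<Rightarrow> ('n \<times> 'n) set" where
  "Ebar G = {(i, j). i < j \<and> {i, j} \<in> graph_compl G}"

text \<open>Coordinate of the vectorisation of a matrix over \<open>Ebar\<close>; no ordering of \<open>Ebar\<close> is needed.\<close>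

definition vec_coord :: "real^'n^'n \<Rightarrow> 'n \<times> 'n \<Rightarrow> real" where
  "vec_coord M p = M $ fst p $ snd p"

definition unit_mat :: "'n \<Rightarrow> 'n \<Rightarrow> real^'n^'n" where
  "unit_mat k l = (\<chi> i j. if i = k \<and> j = l then 1 else 0)"

definition skew_mat :: "'n \<Rightarrow> 'n \<Rightarrow> real^'n^'n" where
  "skew_mat k l = unit_mat k l - unit_mat l k"

definition Psi_S :: "'n::{finite,linorder} set set \<Rightarrow>
    real^'n::{finite,linorder}^'n::{finite,linorder} \<Rightarrow>
    ('n \<times> 'n, 'n \<times> 'n) imat" where
  "Psi_S G A = \<lparr> row_ix = Ebar G,
                 col_ix = {(k, l). k < l},
                 entry = (\<lambda>p (k, l). vec_coord (A ** skew_mat k l + skew_mat l k ** A) p) \<rparr>"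

definition Psi_M :: "'n::{finite,linorder} set set \<Rightarrow>
    real^'n::{finite,linorder}^'n::{finite,linorder} \<Rightarrow>
    ('n \<times> 'n, ('n \<times> 'n) + nat) imat" where
  "Psi_M G A = \<lparr> row_ix = Ebar G,
                 col_ix = col_ix (Psi_S G A) <+> {0..<card (eigvals A)},
                 entry = (\<lambda>p. case_sum (entry (Psi_S G A) p) (\<lambda>k. vec_coord (mat_pow A k) p)) \<rparr>"

definition Psi_A :: "'n::{finite,linorder} set set \<Rightarrow>
    real^'n::{finite,linorder}^'n::{finite,linorder} \<Rightarrow>
    ('n \<times> 'n, 'n \<times> 'n) imat" where
  "Psi_A G A = \<lparr> row_ix = Ebar G,
                 col_ix = UNIV,
                 entry = (\<lambda>p (k, l). vec_coord (A ** unit_mat k l + unit_mat l k ** A) p) \<rparr>"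

definition supp_graph :: "real^('n::finite \<times> 'n) \<Rightarrow> 'n set set" where
  "supp_graph x = (\<lambda>(i, j). {i, j}) ` supp x"

definition perturbable_to :: "real^'n^'n \<Rightarrow> (real^'n^'n \<Rightarrow> bool) \<Rightarrow> bool" where
  "perturbable_to A P \<longleftrightarrow> (\<forall>\<epsilon>>0. \<exists>A'. dist A' A < \<epsilon> \<and> P A')"

end

theory Submission
  imports Defs
begin

text \<open>
  Move \<open>A\<close> along \<open>\<Phi>(K, D) = Q(K)\<^sup>T (A + D) Q(K)\<close>, where \<open>Q(K)\<close> is the Cayley transform of a
  skew-symmetric \<open>K\<close> (SSP, SMP) or \<open>I + K\<close> (SAP), and \<open>D\<close> is \<open>0\<close> or, for the SMP, a small
  linear combination of powers of \<open>A\<close>, which shifts the eigenvalues without reordering or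
  merging them. The columns of the verification matrix are the derivatives of \<open>\<Phi>\<close> at \<open>0\<close>, so \<open>x\<close> is the
  derivative in some direction \<open>v\<close>. Independence of the rows outside the support of \<open>x\<close> means that
  the derivative is onto those coordinates, so the vanishing entries can be kept at zero by a
  correction of order \<open>o(t)\<close> to \<open>t v\<close>, while the entries on the support become \<open>t x + o(t) \<noteq> 0\<close>. The
  strong property holds because a violating \<open>X\<close> is supported on precisely these rows and is a linear
  dependence among them for the perturbed matrix, and independence of rows is an open condition.
\<close>

subsection \<open>Zeros near a direction\<close>

text \<open>
  Brouwer's theorem replaces the implicit function theorem: differentiability at \<open>0\<close> and
  continuity suffice. \<open>P\<close> is the projection onto the coordinates that are to vanish, and \<open>R\<close> a
  right inverse of the derivative on its range.
\<close>

lemma zero_near_direction: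
  fixes f :: "'w::real_normed_vector \<Rightarrow> 'b::euclidean_space"
  assumes deriv: "(f has_derivative L) (at 0)" and cont: "continuous_on UNIV f" and f0: "f 0 = 0"
    and P: "linear P" "\<And>z. P (P z) = P z" "\<And>u. P (f u) = f u"
    and R: "linear R" "\<And>z. L (R z) = P z" and v: "L v = 0"
    and e: "\<epsilon> > 0"
  shows "\<exists>t0>0. \<forall>t. 0 < t \<and> t < t0 \<longrightarrow>
           (\<exists>u. u \<in> span (insert v (range R)) \<and> f u = 0 \<and> norm (u - t *\<^sub>R v) \<le> \<epsilon> * t)"
proof -
  interpret L: bounded_linear L
    using deriv by (rule has_derivative_bounded_linear)
  have blR: "bounded_linear R"
    using R(1) linear_conv_bounded_linear by blast
  obtain C where C: "C > 0" "\<And>z. norm (R z) \<le> norm z * C"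
    using bounded_linear.pos_bounded[OF blR] by blast
  \<comment> \<open>\<open>\<rho>\<close> is the largest radius on which \<open>R z\<close> is sure
    to stay within \<open>\<epsilon>\<close>. \<open>M\<close> bounds \<open>v + R z\<close> there,
    so the remainder tolerance \<open>\<rho> / M\<close> below makes the error of \<open>f\<close>
    at \<open>t *\<^sub>R (v + R z)\<close> at most \<open>\<rho> * t\<close>.\<close>
  define \<rho> where "\<rho> = \<epsilon> / C"
  define M where "M = norm v + \<epsilon> + 1"
  have \<rho>: "\<rho> > 0" using e C by (simp add: \<rho>_def)
  have M: "M > 0" using e by (simp add: M_def add_nonneg_pos)
  have Rz: "norm (R z) \<le> \<epsilon>" if "norm z \<le> \<rho>" for z
  proof -
    have "norm (R z) \<le> \<rho> * C" using C that by (meson mult_right_mono less_imp_le order_trans)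
    then show ?thesis using C by (simp add: \<rho>_def)
  qed
  have Mz: "norm (v + R z) \<le> M" if "norm z \<le> \<rho>" for z
    using Rz[OF that] norm_triangle_ineq[of v "R z"] by (simp add: M_def)
  obtain d where d: "d > 0" "\<And>u. norm u < d \<Longrightarrow> norm (f u - L u) \<le> (\<rho> / M) * norm u"
  proof -
    have "\<rho> / M > 0" using \<rho> M by simp
    then show ?thesis
      using deriv that unfolding has_derivative_at_alt by (metis diff_zero f0)
  qed
  show ?thesis
  proof (intro exI[of _ "d / M"] conjI allI impI)
    show "d / M > 0" using d M by simp
    fix t assume t: "0 < t \<and> t < d / M"
    \<comment> \<open>The linear part of \<open>f\<close> at \<open>t *\<^sub>R (v + R z)\<close> is
      \<open>t *\<^sub>R P z\<close>, since \<open>L v = 0\<close>. Thus \<open>g z\<close> is just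
      the negated remainder divided by \<open>t\<close>, and \<open>g\<close> maps the ball of
      radius \<open>\<rho>\<close> into itself.\<close>
    define g where "g z = P z - (1 / t) *\<^sub>R f (t *\<^sub>R (v + R z))" for z
    have "g z \<in> cball 0 \<rho>" if z: "z \<in> cball 0 \<rho>" for z
    proof -
      define u where "u = t *\<^sub>R (v + R z)"
      have nu: "norm u \<le> t * M"
        using Mz[of z] z t by (simp add: u_def)
      also have "\<dots> < d" using t M by (simp add: field_simps)
      finally have "norm (f u - L u) \<le> (\<rho> / M) * norm u" by (rule d(2))
      also have "\<dots> \<le> (\<rho> / M) * (t * M)" using nu \<rho> M by (intro mult_left_mono) auto
      also have "\<dots> = \<rho> * t" using M by simp
      finally have *: "norm (f u - L u) \<le> \<rho> * t" .
      have "L u = t *\<^sub>R P z" by (simp add: u_def L.scaleR L.add v R(2))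
      then have "g z = (1 / t) *\<^sub>R (L u - f u)"
        using t by (simp add: g_def u_def scaleR_diff_right)
      then have "norm (g z) = norm (f u - L u) / t"
        using t by (simp add: norm_minus_commute)
      then show ?thesis using * t by (simp add: pos_divide_le_eq)
    qed
    moreover have "continuous_on (cball 0 \<rho>) g"
      unfolding g_def
      using P(1) R(1)
      by (intro continuous_intros linear_continuous_on continuous_on_compose2[OF cont])
        (auto simp: linear_conv_bounded_linear)
    ultimately obtain z where z: "z \<in> cball 0 \<rho>" "g z = z"
      using brouwer_ball[OF \<rho>, of 0 g] by auto
    \<comment> \<open>At the fixed point this gives \<open>P z = z\<close>, so the definition of
      \<open>g\<close> leaves only the term with \<open>f\<close>, which must vanish.\<close>
    have "P (g z) = g z"
      using P by (simp add: g_def linear_diff linear_scale)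
    then have fz: "f (t *\<^sub>R (v + R z)) = 0"
      using z(2) t by (simp add: g_def)
    have "t *\<^sub>R (v + R z) \<in> span (insert v (range R))"
      by (intro span_scale span_add) (auto intro: span_base)
    moreover have "norm (t *\<^sub>R (v + R z) - t *\<^sub>R v) \<le> \<epsilon> * t"
      using Rz[of z] z t by (simp add: scaleR_add_right mult.commute)
    ultimately show "\<exists>u. u \<in> span (insert v (range R)) \<and> f u = 0 \<and> norm (u - t *\<^sub>R v) \<le> \<epsilon> * t"
      using fz by blast
  qed
qed

text \<open>Applies \<open>zero_near_direction\<close> to \<open>\<pi> \<circ> \<Phi>\<close> and
  carries the estimate over to the values of \<open>\<Phi>\<close>. The deviation of
  \<open>\<Phi> u\<close> from \<open>\<Phi> 0 + t *\<^sub>R L v\<close> is the differentiability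
  remainder plus \<open>L (u - t *\<^sub>R v)\<close>; each gets half of the allowance.\<close>

lemma perturb_along_direction:
  fixes \<Phi> :: "'w::real_normed_vector \<Rightarrow> 'm::real_normed_vector" and \<pi> :: "'m \<Rightarrow> 'b::euclidean_space"
  assumes deriv: "(\<Phi> has_derivative L) (at 0)" and cont: "continuous_on UNIV \<Phi>"
    and \<pi>: "bounded_linear \<pi>" "\<pi> (\<Phi> 0) = 0"
    and P: "linear P" "\<And>z. P (P z) = P z" "\<And>y. P (\<pi> y) = \<pi> y"
    and R: "linear R" "\<And>z. \<pi> (L (R z)) = P z" and v: "\<pi> (L v) = 0"
    and e: "\<epsilon> > 0"
  shows "\<exists>t0>0. \<forall>t. 0 < t \<and> t < t0 \<longrightarrow>
           (\<exists>u. u \<in> span (insert v (range R)) \<and> \<pi> (\<Phi> u) = 0 \<and> norm u \<le> \<epsilon> \<and>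
                norm (\<Phi> u - \<Phi> 0 - t *\<^sub>R L v) \<le> \<epsilon> * t)"
proof -
  interpret L: bounded_linear L
    using deriv by (rule has_derivative_bounded_linear)
  obtain C where C: "C > 0" "\<And>z. norm (L z) \<le> norm z * C"
    using L.pos_bounded by blast
  \<comment> \<open>The bound 1 yields \<open>norm u \<le> t * M\<close>; the bound
    \<open>\<epsilon> / (2 * C)\<close> makes \<open>L (u - t *\<^sub>R v)\<close> at most
    \<open>\<epsilon> / 2 * t\<close>.\<close>
  define \<delta> where "\<delta> = min 1 (\<epsilon> / (2 * C))"
  define M where "M = norm v + 1"
  have \<delta>: "\<delta> > 0" using e C by (simp add: \<delta>_def)
  have M: "M > 0" by (simp add: M_def add_nonneg_pos)
  obtain d where d: "d > 0" "\<And>u. norm u < d \<Longrightarrow> norm (\<Phi> u - \<Phi> 0 - L u) \<le> (\<epsilon> / (2 * M)) * norm u"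
  proof -
    have "\<epsilon> / (2 * M) > 0" using e M by simp
    then show ?thesis
      using deriv that unfolding has_derivative_at_alt by (metis diff_zero)
  qed
  have "((\<lambda>u. \<pi> (\<Phi> u)) has_derivative (\<lambda>u. \<pi> (L u))) (at 0)"
    using bounded_linear.has_derivative[OF \<pi>(1) deriv] .
  then obtain t0 where t0: "t0 > 0" and t0': "\<And>t. 0 < t \<and> t < t0 \<Longrightarrow>
           (\<exists>u. u \<in> span (insert v (range R)) \<and> \<pi> (\<Phi> u) = 0 \<and> norm (u - t *\<^sub>R v) \<le> \<delta> * t)"
    using zero_near_direction[of "\<lambda>u. \<pi> (\<Phi> u)" "\<lambda>u. \<pi> (L u)" P R v \<delta>]
      bounded_linear.continuous_on[OF \<pi>(1) cont] P R v \<pi>(2) \<delta> by blast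
  show ?thesis
  proof (intro exI[of _ "min t0 (min (d / M) (\<epsilon> / M))"] conjI allI impI)
    show "0 < min t0 (min (d / M) (\<epsilon> / M))"
      using t0 d(1) M e by simp
    fix t assume t: "0 < t \<and> t < min t0 (min (d / M) (\<epsilon> / M))"
    then obtain u where u: "u \<in> span (insert v (range R))" "\<pi> (\<Phi> u) = 0"
        "norm (u - t *\<^sub>R v) \<le> \<delta> * t"
      using t0'[of t] by auto
    have "norm u \<le> norm (t *\<^sub>R v) + norm (u - t *\<^sub>R v)"
      using norm_triangle_sub[of u "t *\<^sub>R v"] by simp
    also have "\<dots> \<le> t * norm v + 1 * t"
      using u(3) t by (intro add_mono order_trans[OF u(3)] mult_right_mono) (auto simp: \<delta>_def)
    also have "\<dots> = t * M" by (simp add: M_def algebra_simps)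
    finally have nu: "norm u \<le> t * M" .
    have tM: "t * M < d" "t * M < \<epsilon>"
      using t M by (auto simp: field_simps)
    have "norm (\<Phi> u - \<Phi> 0 - L u) \<le> (\<epsilon> / (2 * M)) * norm u"
      using nu tM by (intro d(2)) simp
    also have "\<dots> \<le> (\<epsilon> / (2 * M)) * (t * M)" using nu e M by (intro mult_left_mono) auto
    also have "\<dots> = \<epsilon> / 2 * t" using M by simp
    finally have 1: "norm (\<Phi> u - \<Phi> 0 - L u) \<le> \<epsilon> / 2 * t" .
    have "norm (L (u - t *\<^sub>R v)) \<le> norm (u - t *\<^sub>R v) * C" by (rule C(2))
    also have "\<dots> \<le> (\<delta> * t) * C" using u(3) C(1) by (intro mult_right_mono) auto
    also have "\<dots> \<le> (\<epsilon> / (2 * C) * t) * C"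
      using C(1) t by (intro mult_right_mono) (auto simp: \<delta>_def)
    also have "\<dots> = \<epsilon> / 2 * t" using C(1) by simp
    finally have 2: "norm (L (u - t *\<^sub>R v)) \<le> \<epsilon> / 2 * t" .
    have "\<Phi> u - \<Phi> 0 - t *\<^sub>R L v = (\<Phi> u - \<Phi> 0 - L u) + L (u - t *\<^sub>R v)"
      by (simp add: L.diff L.scaleR)
    then have "norm (\<Phi> u - \<Phi> 0 - t *\<^sub>R L v) \<le> \<epsilon> / 2 * t + \<epsilon> / 2 * t"
      using 1 2 norm_triangle_mono by metis
    then show "\<exists>u. u \<in> span (insert v (range R)) \<and> \<pi> (\<Phi> u) = 0 \<and> norm u \<le> \<epsilon> \<and>
                norm (\<Phi> u - \<Phi> 0 - t *\<^sub>R L v) \<le> \<epsilon> * t"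
      using u nu tM by (intro exI[of _ u]) auto
  qed
qed

subsection \<open>Rows and columns of verification matrices\<close>

text \<open>Row rank equals column rank, in coordinates: split the unit vector at \<open>p\<close>
  orthogonally along the space \<open>V\<close> of column combinations restricted to
  \<open>N\<close>. The part orthogonal to \<open>V\<close> is a linear dependence among the rows in
  \<open>N\<close>, hence zero on \<open>N\<close>.\<close>

lemma rows_independent_dual:
  assumes "rows_independent M N" and "p \<in> N" and fin: "finite (col_ix M)"
  shows "\<exists>c. \<forall>p'\<in>N. (\<Sum>j\<in>col_ix M. c j * entry M p' j) = (if p' = p then 1 else 0)"
proof -
  define W where "W c = (\<chi> i. if i \<in> N then (\<Sum>j\<in>col_ix M. c j * entry M i j) else 0)" for c
  define V where "V = range W"
  have add: "W c + W d = W (\<lambda>j. c j + d j)" for c d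
    by (simp add: W_def vec_eq_iff sum.distrib distrib_right)
  have scale: "r *\<^sub>R W c = W (\<lambda>j. r * c j)" for r c
    by (simp add: W_def vec_eq_iff sum_distrib_left mult.assoc)
  have zero: "0 = W (\<lambda>_. 0)"
    by (simp add: W_def vec_eq_iff)
  have sub: "subspace V"
    unfolding V_def by (rule subspaceI) (auto simp: add scale zero)
  obtain y z where yz: "y \<in> V" "\<And>w. w \<in> V \<Longrightarrow> orthogonal z w" "axis p 1 = y + z"
    using orthogonal_subspace_decomp_exists[of V "axis p (1::real)"] sub by (metis span_eq_iff)
  \<comment> \<open>Each column cut down to \<open>N\<close> is itself in \<open>V\<close>, so
    orthogonality of \<open>z\<close> to it is a relation among the rows.\<close>
  have col: "(\<Sum>i\<in>N. z $ i * entry M i j) = 0" if j: "j \<in> col_ix M" for j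
  proof -
    have "(\<chi> i. if i \<in> N then entry M i j else 0) = W (\<lambda>k. if k = j then 1 else 0)"
      using fin j by (simp add: W_def vec_eq_iff if_distrib[of "\<lambda>a. a * _"] cong: if_cong)
    then have "(\<chi> i. if i \<in> N then entry M i j else 0) \<in> V"
      unfolding V_def by blast
    from yz(2)[OF this] show ?thesis
      by (simp add: orthogonal_def inner_vec_def if_distrib[of "\<lambda>a. _ * a"] sum.If_cases cong: if_cong)
  qed
  then have z0: "z $ i = 0" if "i \<in> N" for i
    using assms(1) that unfolding rows_independent_def by blast
  obtain c where c: "y = W c"
    using yz(1) unfolding V_def by blast
  have "(\<Sum>j\<in>col_ix M. c j * entry M i j) = (if i = p then 1 else 0)" if i: "i \<in> N" for i
  proof -
    have "(axis p 1 :: real^'a) $ i = y $ i + z $ i" using yz(3) by simp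
    then show ?thesis using i z0[OF i] by (simp add: c W_def axis_def)
  qed
  then show ?thesis by blast
qed

lemma column_space_coeffs:
  assumes "y \<in> column_space M" and fin: "finite (col_ix M)"
  shows "\<exists>c. \<forall>p. y $ p = (if p \<in> row_ix M then \<Sum>j\<in>col_ix M. c j * entry M p j else 0)"
  using assms(1) unfolding column_space_def
proof (induction rule: span_induct_alt)
  case base
  show ?case by (rule exI[of _ "\<lambda>_. 0"]) simp
next
  case (step r w y)
  then obtain j c where j: "j \<in> col_ix M" "w = col_vec M j"
    and c: "\<forall>p. y $ p = (if p \<in> row_ix M then \<Sum>j\<in>col_ix M. c j * entry M p j else 0)" by blast
  have "(\<Sum>k\<in>col_ix M. (c(j := c j + r)) k * entry M p k) =
        r * entry M p j + (\<Sum>k\<in>col_ix M. c k * entry M p k)" for p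
    using fin j(1) by (simp add: sum.remove[of _ j] algebra_simps)
  then show ?case
    using c j(2) by (intro exI[of _ "c(j := c j + r)"]) (simp add: col_vec_def)
qed

text \<open>A matrix entrywise close to the identity is injective: compare both sides of the
  equation at the coordinate where \<open>\<bar>a p\<bar>\<close> is largest. This is the form in
  which independence of rows survives a small perturbation.\<close>

lemma diag_dominant_kernel:
  fixes a :: "'r \<Rightarrow> real"
  assumes N: "finite N" and dom: "\<And>p p'. p \<in> N \<Longrightarrow> p' \<in> N \<Longrightarrow> \<bar>m p p' - (if p' = p then 1 else 0)\<bar> \<le> \<eta>"
    and small: "real (card N) * \<eta> < 1"
    and ker: "\<And>p. p \<in> N \<Longrightarrow> (\<Sum>p'\<in>N. a p' * m p p') = 0"
  shows "\<forall>p\<in>N. a p = 0"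
proof (cases "N = {}")
  case False
  have "Max ((\<lambda>p. \<bar>a p\<bar>) ` N) \<in> (\<lambda>p. \<bar>a p\<bar>) ` N"
    using False N by (intro Max_in) auto
  then obtain q where q: "q \<in> N" "Max ((\<lambda>p. \<bar>a p\<bar>) ` N) = \<bar>a q\<bar>" by blast
  have q': "\<bar>a p\<bar> \<le> \<bar>a q\<bar>" if "p \<in> N" for p
    using N that by (simp flip: q(2))
  have "a q = (\<Sum>p'\<in>N. a p' * (if p' = q then 1 else 0))"
    using N q(1) by (simp add: if_distrib[of "\<lambda>b. _ * b"] cong: if_cong)
  also have "\<dots> = - (\<Sum>p'\<in>N. a p' * (m q p' - (if p' = q then 1 else 0)))"
    using ker[OF q(1)] by (simp add: right_diff_distrib sum_subtractf)
  finally have "\<bar>a q\<bar> = \<bar>\<Sum>p'\<in>N. a p' * (m q p' - (if p' = q then 1 else 0))\<bar>"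
    by simp
  also have "\<dots> \<le> (\<Sum>p'\<in>N. \<bar>a p' * (m q p' - (if p' = q then 1 else 0))\<bar>)"
    by (rule sum_abs)
  also have "\<dots> \<le> (\<Sum>p'\<in>N. \<bar>a q\<bar> * \<eta>)"
    unfolding abs_mult using q(1) q' dom by (intro sum_mono mult_mono) auto
  also have "\<dots> = (real (card N) * \<eta>) * \<bar>a q\<bar>" by simp
  finally have "(1 - real (card N) * \<eta>) * \<bar>a q\<bar> \<le> 0" by (simp add: left_diff_distrib)
  then have "\<bar>a q\<bar> = 0" using small by (simp add: mult_le_0_iff)
  then show ?thesis using q' by fastforce
qed simp

subsection \<open>Matrix algebra\<close>

lemma sym_mat_iff: "sym_mat B \<longleftrightarrow> (\<forall>i j. B $ i $ j = B $ j $ i)"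
  by (auto simp: sym_mat_def transpose_def vec_eq_iff)

lemma sym_matD: "sym_mat B \<Longrightarrow> B $ i $ j = B $ j $ i"
  by (simp add: sym_mat_iff)

lemma bounded_bilinear_matrix_mult:
  "bounded_bilinear ((**) :: real^'n^'m \<Rightarrow> real^'p^'n \<Rightarrow> real^'p^'m)"
  unfolding bilinear_conv_bounded_bilinear[symmetric] bilinear_def
  by (intro conjI allI linearI)
    (simp_all add: matrix_matrix_mult_def vec_eq_iff sum.distrib algebra_simps sum_distrib_left)

interpretation matrix_mult: bounded_bilinear "(**) :: real^'n^'m \<Rightarrow> real^'p^'n \<Rightarrow> real^'p^'m"
  by (rule bounded_bilinear_matrix_mult)

lemma bounded_linear_transpose: "bounded_linear (transpose :: real^'n^'m \<Rightarrow> real^'m^'n)"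
  unfolding linear_conv_bounded_linear[symmetric]
  by (rule linearI) (simp_all add: transpose_def vec_eq_iff)

lemma transpose_diff: "transpose (X - Y :: real^'n^'m) = transpose X - transpose Y"
  by (simp add: transpose_def vec_eq_iff)

lemma transpose_add: "transpose (X + Y :: real^'n^'m) = transpose X + transpose Y"
  by (simp add: transpose_def vec_eq_iff)

lemma transpose_zero [simp]: "transpose (0 :: real^'n^'m) = 0"
  by (simp add: transpose_def vec_eq_iff)

lemma has_derivative_quadratic_bound:
  fixes f :: "'a::real_normed_vector \<Rightarrow> 'b::real_normed_vector"
  assumes L: "bounded_linear L" and bound: "\<And>h. norm (f h - f 0 - L h) \<le> C * (norm h)\<^sup>2"
  shows "(f has_derivative L) (at 0)"
  unfolding has_derivative_at_alt
proof (intro conjI allI impI L)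
  fix e :: real assume e: "e > 0"
  show "\<exists>d>0. \<forall>y. norm (y - 0) < d \<longrightarrow> norm (f y - f 0 - L (y - 0)) \<le> e * norm (y - 0)"
  \<comment> \<open>\<open>\<bar>C\<bar> + 1\<close> replaces \<open>C\<close> because the sign of
    \<open>C\<close> is not prescribed and the quotient needs a positive denominator.\<close>
  proof (intro exI[of _ "e / (\<bar>C\<bar> + 1)"] conjI allI impI)
    show "e / (\<bar>C\<bar> + 1) > 0" using e by (intro divide_pos_pos) auto
    fix y :: 'a assume "norm (y - 0) < e / (\<bar>C\<bar> + 1)"
    then have "(\<bar>C\<bar> + 1) * norm y \<le> e" by (simp add: field_simps)
    then have "(\<bar>C\<bar> + 1) * norm y * norm y \<le> e * norm y" by (intro mult_right_mono) auto
    moreover have "C * (norm y)\<^sup>2 \<le> (\<bar>C\<bar> + 1) * (norm y)\<^sup>2" by (intro mult_right_mono) auto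
    ultimately show "norm (f y - f 0 - L (y - 0)) \<le> e * norm (y - 0)"
      using bound[of y] by (simp add: power2_eq_square mult.assoc)
  qed
qed

subsection \<open>The Cayley transform\<close>

text \<open>
  The factor \<open>1 / 4\<close> makes the derivative of \<open>cayley\<close> at \<open>0\<close> the identity on skew-symmetric
  matrices; projecting to the skew part keeps \<open>cayley\<close> orthogonal and continuous everywhere.
\<close>

definition half_skew :: "real^'n^'n \<Rightarrow> real^'n^'n" where
  "half_skew K = (1 / 4) *\<^sub>R (K - transpose K)"

definition resolvent :: "real^'n^'n \<Rightarrow> real^'n^'n" where
  "resolvent K = matrix_inv (mat 1 - half_skew K)"

definition cayley :: "real^'n^'n \<Rightarrow> real^'n^'n" where
  "cayley K = resolvent K ** (mat 1 + half_skew K)"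

lemma transpose_half_skew: "transpose (half_skew K) = - half_skew K"
  by (simp add: half_skew_def transpose_scalar transpose_diff scaleR_diff_right)

lemma bounded_linear_half_skew: "bounded_linear half_skew"
  unfolding half_skew_def
  by (intro bounded_linear_intros bounded_linear_transpose)

lemma half_skew_0 [simp]: "half_skew 0 = 0"
  by (simp add: half_skew_def)

text \<open>For skew \<open>S\<close> the vectors \<open>v\<close> and \<open>S *v v\<close> are
  orthogonal, so Pythagoras applies. Hence \<open>mat 1 - S\<close> is injective and its inverse
  does not increase norms.\<close>

lemma norm_le_one_minus_skew:
  fixes S :: "real^'n^'n"
  assumes "transpose S = - S"
  shows "norm v \<le> norm ((mat 1 - S) *v v)"
proof -
  have "v \<bullet> (S *v v) = (transpose S *v v) \<bullet> v"
    by (simp add: dot_lmul_matrix)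
  then have "v \<bullet> (S *v v) = (- S *v v) \<bullet> v"
    unfolding assms .
  then have 0: "v \<bullet> (S *v v) = 0"
    using matrix_vector_mult_diff_rdistrib[of 0 S v] by (simp add: inner_commute)
  have "(norm v)\<^sup>2 \<le> (norm v)\<^sup>2 + (norm (S *v v))\<^sup>2" by simp
  also have "\<dots> = (norm ((mat 1 - S) *v v))\<^sup>2"
    using 0 by (simp add: power2_norm_eq_inner matrix_vector_mult_diff_rdistrib inner_diff inner_commute)
  finally show ?thesis by (rule power2_le_imp_le) simp
qed

lemma resolvent_inverse:
  shows "resolvent K ** (mat 1 - half_skew K) = mat 1" "(mat 1 - half_skew K) ** resolvent K = mat 1"
proof -
  have "\<And>v. (mat 1 - half_skew K) *v v = 0 \<Longrightarrow> v = 0"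
    using norm_le_one_minus_skew[OF transpose_half_skew] by (metis norm_eq_zero norm_le_zero_iff)
  then have "invertible (mat 1 - half_skew K)"
    by (simp add: invertible_left_inverse matrix_left_invertible_ker)
  then show "resolvent K ** (mat 1 - half_skew K) = mat 1" "(mat 1 - half_skew K) ** resolvent K = mat 1"
    unfolding resolvent_def matrix_inv_def invertible_def by (metis (mono_tags, lifting) someI_ex)+
qed

lemma resolvent_0 [simp]: "resolvent 0 = mat 1"
  using resolvent_inverse(1)[of 0] by simp

text \<open>The columns of \<open>resolvent K\<close> are preimages of unit vectors under
  \<open>mat 1 - half_skew K\<close>, so all entries are at most 1 in modulus. Only the uniformity
  in \<open>K\<close> matters, not the size of the bound.\<close>

lemma norm_resolvent_le: "norm (resolvent K :: real^'n^'n) \<le> (real CARD('n))\<^sup>2"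
proof -
  have entry: "\<bar>resolvent K $ i $ j\<bar> \<le> 1" for i j
  proof -
    have "norm (resolvent K *v axis j 1) \<le> norm ((mat 1 - half_skew K) *v (resolvent K *v axis j 1))"
      by (rule norm_le_one_minus_skew[OF transpose_half_skew])
    also have "\<dots> = 1"
      by (simp add: matrix_vector_mul_assoc resolvent_inverse)
    finally have "norm (column j (resolvent K)) \<le> 1"
      by (simp add: matrix_vector_mul_component matrix_vector_mult_basis)
    then show ?thesis
      using component_le_norm_cart[of "column j (resolvent K)" i] by (simp add: column_def)
  qed
  have "norm (resolvent K) \<le> (\<Sum>i\<in>UNIV. norm (resolvent K $ i))"
    unfolding norm_vec_def by (rule L2_set_le_sum) simp
  also have "\<dots> \<le> (\<Sum>i\<in>(UNIV::'n set). \<Sum>j\<in>(UNIV::'n set). \<bar>resolvent K $ i $ j\<bar>)"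
    by (intro sum_mono norm_le_l1_cart)
  also have "\<dots> \<le> (\<Sum>i\<in>(UNIV::'n set). \<Sum>j\<in>(UNIV::'n set). 1)"
    by (intro sum_mono entry)
  also have "\<dots> = (real CARD('n))\<^sup>2" by (simp add: power2_eq_square)
  finally show ?thesis .
qed

text \<open>The resolvent identity. With the uniform bound it makes \<open>resolvent\<close>
  Lipschitz, and with \<open>K' = 0\<close> it gives the derivative at 0.\<close>

lemma resolvent_diff:
  "resolvent K - resolvent K' = resolvent K ** (half_skew K - half_skew K') ** resolvent K'"
proof -
  have "resolvent K ** (half_skew K - half_skew K') ** resolvent K' =
      resolvent K ** ((mat 1 - half_skew K') - (mat 1 - half_skew K)) ** resolvent K'"
    by simp
  also have "\<dots> = resolvent K ** ((mat 1 - half_skew K') ** resolvent K') -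
      (resolvent K ** (mat 1 - half_skew K)) ** resolvent K'"
    by (simp only: matrix_mult.diff_left matrix_mult.diff_right matrix_mul_assoc)
  finally show ?thesis by (simp add: resolvent_inverse)
qed

lemma norm_matrix_mult3_le:
  "\<exists>C\<ge>0. \<forall>(X::real^'n^'n) (Y::real^'n^'n) (Z::real^'n^'n). norm (X ** Y ** Z) \<le> C * (norm X * norm Y * norm Z)"
proof -
  obtain C where C: "C \<ge> 0" "\<And>(X::real^'n^'n) (Y::real^'n^'n). norm (X ** Y) \<le> norm X * norm Y * C"
    using matrix_mult.nonneg_bounded by blast
  have "norm (X ** Y ** Z) \<le> (C * C) * (norm X * norm Y * norm Z)" for X Y Z :: "real^'n^'n"
  proof -
    have "norm (X ** Y ** Z) \<le> norm (X ** Y) * norm Z * C" by (rule C(2))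
    also have "\<dots> \<le> (norm X * norm Y * C) * norm Z * C"
      using C by (intro mult_right_mono) auto
    finally show ?thesis by (simp add: mult_ac)
  qed
  then show ?thesis using C(1) by (intro exI[of _ "C * C"]) auto
qed

lemma continuous_on_resolvent: "continuous_on UNIV (resolvent :: real^'n^'n \<Rightarrow> real^'n^'n)"
proof -
  let ?n = "(real CARD('n))\<^sup>2"
  obtain C where C: "C \<ge> 0" "\<And>(X::real^'n^'n) (Y::real^'n^'n) (Z::real^'n^'n). norm (X ** Y ** Z) \<le> C * (norm X * norm Y * norm Z)"
    using norm_matrix_mult3_le by blast
  have bound: "norm (resolvent K - resolvent K' :: real^'n^'n) \<le>
      C * (?n * norm (half_skew K - half_skew K') * ?n)" for K K' :: "real^'n^'n"
    unfolding resolvent_diff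
    by (rule order_trans[OF C(2)])
      (intro mult_left_mono mult_mono C(1) norm_resolvent_le mult_nonneg_nonneg; simp)
  have lim: "((\<lambda>K. C * (?n * norm (half_skew K - half_skew K0) * ?n)) \<longlongrightarrow>
      C * (?n * norm (half_skew K0 - half_skew K0) * ?n)) (at K0)" for K0 :: "real^'n^'n"
    by (intro tendsto_intros bounded_linear.tendsto[OF bounded_linear_half_skew])
  have "(\<lambda>K. resolvent K - resolvent K0) \<midarrow>K0\<rightarrow> 0" for K0 :: "real^'n^'n"
    by (rule Lim_null_comparison[OF _ lim[of K0, simplified]]) (use bound in auto)
  then show ?thesis
    by (simp add: continuous_on_eq_continuous_at isCont_def LIM_zero_iff)
qed

lemma resolvent_derivative:
  "((resolvent :: real^'n^'n \<Rightarrow> real^'n^'n) has_derivative half_skew) (at 0)"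
proof -
  let ?n = "(real CARD('n))\<^sup>2"
  obtain C where C: "C \<ge> 0" "\<And>(X::real^'n^'n) (Y::real^'n^'n) (Z::real^'n^'n). norm (X ** Y ** Z) \<le> C * (norm X * norm Y * norm Z)"
    using norm_matrix_mult3_le by blast
  obtain c where c: "c \<ge> 0" "\<And>K :: real^'n^'n. norm (half_skew K) \<le> norm K * c"
    using bounded_linear.nonneg_bounded[OF bounded_linear_half_skew] by blast
  \<comment> \<open>Two uses of the resolvent identity against 0 expand \<open>resolvent K\<close>
    to first order, with a remainder quadratic in \<open>half_skew K\<close>.\<close>
  have eq: "resolvent K - resolvent 0 - half_skew K = resolvent K ** half_skew K ** half_skew K" for K :: "real^'n^'n"
  proof -
    have "resolvent K - mat 1 = resolvent K ** half_skew K"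
      using resolvent_diff[of K 0] by simp
    then have "resolvent K ** half_skew K ** half_skew K = (resolvent K - mat 1) ** half_skew K" by simp
    also have "\<dots> = resolvent K ** half_skew K - half_skew K" by (simp add: matrix_mult.diff_left)
    finally show ?thesis using resolvent_diff[of K 0] by simp
  qed
  have "norm (resolvent K - resolvent 0 - half_skew K) \<le> (C * ?n * c * c) * (norm K)\<^sup>2" for K :: "real^'n^'n"
  proof -
    have "norm (resolvent K - resolvent 0 - half_skew K) \<le>
        C * (norm (resolvent K) * norm (half_skew K) * norm (half_skew K))"
      unfolding eq by (rule C(2))
    also have "\<dots> \<le> C * (?n * (norm K * c) * (norm K * c))"
      by (intro mult_left_mono mult_mono C(1) c norm_resolvent_le mult_nonneg_nonneg) auto
    finally show ?thesis by (simp add: power2_eq_square mult_ac)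
  qed
  then show ?thesis by (rule has_derivative_quadratic_bound[OF bounded_linear_half_skew])
qed

lemma cayley_0 [simp]: "cayley 0 = mat 1"
  by (simp add: cayley_def)

lemma cayley_derivative:
  "((cayley :: real^'n^'n \<Rightarrow> real^'n^'n) has_derivative (\<lambda>K. (1 / 2) *\<^sub>R (K - transpose K))) (at 0)"
proof -
  have "((\<lambda>K. mat 1 + half_skew K :: real^'n^'n) has_derivative (\<lambda>K. 0 + half_skew K)) (at 0)"
    by (intro has_derivative_add has_derivative_const bounded_linear.has_derivative[OF bounded_linear_half_skew]
        has_derivative_ident)
  from matrix_mult.FDERIV[OF resolvent_derivative this]
  have "((cayley :: real^'n^'n \<Rightarrow> real^'n^'n) has_derivative (\<lambda>K. mat 1 ** (0 + half_skew K) + half_skew K ** (mat 1 + 0))) (at 0)"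
    by (simp only: cayley_def[abs_def] resolvent_0 half_skew_0)
  moreover have "(\<lambda>K. mat 1 ** (0 + half_skew K) + half_skew K ** (mat 1 + 0)) =
      (\<lambda>K :: real^'n^'n. (1 / 2) *\<^sub>R (K - transpose K))"
    by (simp add: half_skew_def fun_eq_iff flip: scaleR_left_distrib)
  ultimately show ?thesis by (simp only:)
qed

lemma continuous_on_cayley: "continuous_on UNIV cayley"
  unfolding cayley_def[abs_def]
  by (intro matrix_mult.continuous_on continuous_on_resolvent continuous_intros
      linear_continuous_on bounded_linear_half_skew)

text \<open>Transposition exchanges \<open>?M\<close> and \<open>?P\<close>, so
  \<open>transpose ?J\<close> is the inverse of \<open>?P\<close>. Since \<open>?J\<close> commutes
  with \<open>?P\<close>, the product of the transpose with \<open>cayley K\<close> collapses from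
  the inside: first \<open>transpose ?J ** ?P\<close>, then \<open>?M ** ?J\<close>.\<close>

lemma orthogonal_cayley: "orthogonal_matrix (cayley K)"
proof -
  let ?J = "resolvent K" and ?M = "mat 1 - half_skew K" and ?P = "mat 1 + half_skew K"
  have MP: "?M ** ?P = ?P ** ?M"
    by (simp add: matrix_mult.diff_left matrix_mult.diff_right matrix_mult.add_left matrix_mult.add_right)
  have "?J ** ?P = ?J ** (?P ** ?M) ** ?J"
    by (simp add: resolvent_inverse flip: matrix_mul_assoc)
  also have "\<dots> = (?J ** ?M) ** ?P ** ?J"
    unfolding MP[symmetric] by (simp only: matrix_mul_assoc)
  finally have JP: "?J ** ?P = ?P ** ?J" by (simp add: resolvent_inverse)
  have tM: "transpose ?M = ?P" and tP: "transpose ?P = ?M"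
    by (simp_all add: transpose_diff transpose_add transpose_half_skew)
  have "transpose (cayley K) ** cayley K = ?M ** (transpose ?J ** ?P) ** ?J"
    unfolding cayley_def matrix_transpose_mul tP by (simp only: JP matrix_mul_assoc)
  also have "transpose ?J ** ?P = mat 1"
    by (metis matrix_transpose_mul resolvent_inverse(2) tM transpose_mat)
  finally show ?thesis
    by (simp add: orthogonal_matrix resolvent_inverse)
qed

subsection \<open>Eigenvalues of symmetric matrices\<close>

lemma sym_mat_dot: "sym_mat A \<Longrightarrow> (A *v v) \<bullet> w = v \<bullet> (A *v w)"
  unfolding sym_mat_def by (metis dot_lmul_matrix vector_transpose_matrix)

text \<open>Variational argument: maximise \<open>v \<bullet> (A *v v)\<close> over the unit sphere
  of \<open>S\<close>. The maximum \<open>c\<close> makes the form \<open>q\<close> nonnegative on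
  \<open>S\<close> and zero at the maximiser \<open>v\<close>; moving \<open>v\<close> against the
  residual \<open>u\<close> would make \<open>q\<close> negative unless
  \<open>u = 0\<close>.\<close>

lemma sym_mat_eigenvector_in_subspace:
  fixes A :: "real^'n^'n"
  assumes A: "sym_mat A" and S: "subspace S" "\<And>v. v \<in> S \<Longrightarrow> A *v v \<in> S" and ne: "w \<in> S" "w \<noteq> 0"
  shows "\<exists>v\<in>S. v \<noteq> 0 \<and> (\<exists>c. A *v v = c *\<^sub>R v)"
proof -
  let ?K = "S \<inter> sphere 0 1"
  have K: "compact ?K"
    using closed_subspace[OF S(1)] by (intro closed_Int_compact) auto
  have "(1 / norm w) *\<^sub>R w \<in> ?K"
    using ne S(1) by (auto simp: subspace_scale)
  then have K_ne: "?K \<noteq> {}" by blast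
  have "continuous_on ?K (\<lambda>v. v \<bullet> (A *v v))"
    by (intro continuous_intros linear_continuous_on) auto
  then obtain v where v: "v \<in> ?K" "\<And>u. u \<in> ?K \<Longrightarrow> u \<bullet> (A *v u) \<le> v \<bullet> (A *v v)"
    using continuous_attains_sup[OF K K_ne] by blast
  define c where "c = v \<bullet> (A *v v)"
  define q where "q u = c * (u \<bullet> u) - u \<bullet> (A *v u)" for u
  have v1: "v \<in> S" "v \<bullet> v = 1" using v(1) by (auto simp: dot_square_norm)
  have q_nonneg: "q u \<ge> 0" if "u \<in> S" for u
  proof (cases "u = 0")
    case False
    have "(1 / norm u) *\<^sub>R u \<in> ?K"
      using False that S(1) by (auto simp: subspace_scale)
    from v(2)[OF this] have "(u \<bullet> (A *v u)) / (norm u * norm u) \<le> c"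
      by (simp add: c_def matrix_vector_mult_scaleR)
    then show ?thesis using False by (simp add: q_def field_simps norm_eq_sqrt_inner)
  qed (simp add: q_def)
  define u where "u = c *\<^sub>R v - A *v v"
  have u: "u \<in> S" unfolding u_def using v1 S by (intro subspace_diff subspace_scale) auto
  \<comment> \<open>\<open>q v = 0\<close>, and the cross term is \<open>u \<bullet> u\<close> by
    symmetry of \<open>A\<close> and the definition of \<open>u\<close>.\<close>
  have expand: "q (v - t *\<^sub>R u) = t\<^sup>2 * q u - 2 * t * (u \<bullet> u)" for t
  proof -
    have "v \<bullet> (A *v u) = u \<bullet> (A *v v)" using sym_mat_dot[OF A, of v u] by (simp add: inner_commute)
    moreover have "u \<bullet> (c *\<^sub>R v - A *v v) = c * (u \<bullet> v) - u \<bullet> (A *v v)"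
      by (simp add: inner_diff_right)
    then have uu: "u \<bullet> u = c * (u \<bullet> v) - u \<bullet> (A *v v)" by (simp flip: u_def)
    ultimately show ?thesis
      unfolding uu using v1(2)
      by (simp add: q_def matrix_vector_mult_diff_distrib matrix_vector_mult_scaleR inner_diff
          power2_eq_square algebra_simps c_def[symmetric] inner_commute uu)
  qed
  have "u \<bullet> u = 0"
  proof (rule ccontr)
    assume nz: "u \<bullet> u \<noteq> 0"
    \<comment> \<open>Chosen so that \<open>t * q u \<le> u \<bullet> u\<close>, which lets the
      linear term win; the summand 1 covers \<open>q u = 0\<close>.\<close>
    define t where "t = (u \<bullet> u) / (q u + 1)"
    have t: "t > 0" using nz q_nonneg[OF u] by (simp add: t_def less_le)
    have "0 \<le> q (v - t *\<^sub>R u)"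
      using u v1 S by (intro q_nonneg subspace_diff subspace_scale) auto
    then have "0 \<le> t * (t * q u - 2 * (u \<bullet> u))" by (simp add: expand power2_eq_square algebra_simps)
    then have "2 * (u \<bullet> u) \<le> t * q u" using t by (simp add: zero_le_mult_iff)
    also have "\<dots> \<le> t * (q u + 1)" using t by simp
    also have "\<dots> = u \<bullet> u" using q_nonneg[OF u] by (simp add: t_def)
    finally show False using nz inner_ge_zero[of u] by linarith
  qed
  then have "A *v v = c *\<^sub>R v" by (simp add: u_def)
  moreover have "v \<noteq> 0" using v1 by auto
  ultimately show ?thesis using v1 by blast
qed

text \<open>The spectral theorem, stated as totality of the eigenvectors. Their orthogonal
  complement is invariant under \<open>A\<close>; if nonzero, it would contain an eigenvector,
  orthogonal to itself.\<close>

lemma sym_mat_eigenvectors_total: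
  fixes A :: "real^'n^'n"
  assumes A: "sym_mat A" and orth: "\<And>c v. A *v v = c *\<^sub>R v \<Longrightarrow> w \<bullet> v = 0"
  shows "w = 0"
proof (rule ccontr)
  assume w: "w \<noteq> 0"
  let ?E = "{v. \<exists>c. A *v v = c *\<^sub>R v}"
  let ?S = "{w. \<forall>v\<in>?E. orthogonal v w}"
  have "subspace ?S" by (rule subspace_orthogonal_to_vectors)
  moreover have "A *v u \<in> ?S" if "u \<in> ?S" for u
  proof -
    have "orthogonal v (A *v u)" if "A *v v = c *\<^sub>R v" for v c
      using \<open>u \<in> ?S\<close> that sym_mat_dot[OF A, of v u] by (auto simp: orthogonal_def)
    then show ?thesis by blast
  qed
  moreover have "w \<in> ?S"
    using orth by (auto simp: orthogonal_def inner_commute)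
  ultimately obtain v where "v \<in> ?S" "v \<noteq> 0" "v \<in> ?E"
    using sym_mat_eigenvector_in_subspace[OF A, of ?S w] w by blast
  then have "orthogonal v v" by blast
  then show False using \<open>v \<noteq> 0\<close> by (simp add: orthogonal_def)
qed

text \<open>\<open>C\<close> acts as the scalar \<open>f c\<close> on each eigenspace of
  \<open>A\<close>, and these span. Eigenvectors of \<open>C\<close> for other values are orthogonal
  to that eigenspace, so nothing new appears; injectivity of \<open>f\<close> prevents eigenspaces
  from merging.\<close>

lemma eigenspaces_of_function:
  fixes A C :: "real^'n^'n"
  assumes A: "sym_mat A" and C: "sym_mat C"
    and f: "\<And>c v. A *v v = c *\<^sub>R v \<Longrightarrow> C *v v = f c *\<^sub>R v" and inj: "inj_on f (eigvals A)"
  shows "eigvals C = f ` eigvals A" "\<And>c. c \<in> eigvals A \<Longrightarrow> eig_mult C (f c) = eig_mult A c"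
proof -
  have orth: "u \<bullet> v = 0" if "C *v u = \<mu> *\<^sub>R u" "A *v v = c *\<^sub>R v" "f c \<noteq> \<mu>" for u v \<mu> c
  proof -
    have "\<mu> * (u \<bullet> v) = f c * (u \<bullet> v)"
      using sym_mat_dot[OF C, of u v] that(1) f[OF that(2)] by simp
    then show ?thesis using that(3) by simp
  qed
  show "eigvals C = f ` eigvals A"
  proof (intro equalityI subsetI)
    fix \<mu> assume "\<mu> \<in> eigvals C"
    then obtain u where u: "u \<noteq> 0" "C *v u = \<mu> *\<^sub>R u" by (auto simp: eigvals_def)
    then obtain c v where cv: "A *v v = c *\<^sub>R v" "u \<bullet> v \<noteq> 0"
      using sym_mat_eigenvectors_total[OF A] by blast
    then have "c \<in> eigvals A" by (auto simp: eigvals_def intro!: exI[of _ v])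
    moreover have "f c = \<mu>" using orth[OF u(2) cv(1)] cv(2) by blast
    ultimately show "\<mu> \<in> f ` eigvals A" by blast
  next
    fix \<mu> assume "\<mu> \<in> f ` eigvals A"
    then show "\<mu> \<in> eigvals C" using f unfolding eigvals_def by blast
  qed
  show "eig_mult C (f c) = eig_mult A c" if c: "c \<in> eigvals A" for c
  proof -
    \<comment> \<open>The residual \<open>A *v u - c *\<^sub>R u\<close> is orthogonal to every
      eigenvector of \<open>A\<close>: for eigenvalue \<open>c\<close> by the factor
      \<open>d - c\<close>, for any other because \<open>u\<close> itself is.\<close>
    have "A *v u = c *\<^sub>R u" if u: "C *v u = f c *\<^sub>R u" for u
    proof -
      have "(A *v u - c *\<^sub>R u) \<bullet> v = 0" if v: "A *v v = d *\<^sub>R v" for d v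
      proof -
        have eq: "(A *v u - c *\<^sub>R u) \<bullet> v = (d - c) * (u \<bullet> v)"
          using v by (simp add: inner_diff_left sym_mat_dot[OF A] left_diff_distrib)
        show ?thesis
        proof (cases "v = 0 \<or> d = c")
          case False
          then have "d \<in> eigvals A" using v by (auto simp: eigvals_def intro!: exI[of _ v])
          then have "f d \<noteq> f c" using inj c False by (auto dest: inj_onD)
          then show ?thesis using orth[OF u v] eq by simp
        qed (use eq in auto)
      qed
      then have "A *v u - c *\<^sub>R u = 0" by (rule sym_mat_eigenvectors_total[OF A])
      then show ?thesis by simp
    qed
    then have "{v. C *v v = f c *\<^sub>R v} = {v. A *v v = c *\<^sub>R v}" using f by blast
    then show ?thesis by (simp add: eig_mult_def)
  qed
qed

text \<open>\<open>transpose Q\<close> maps each eigenspace of \<open>C\<close> bijectively onto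
  that of the conjugate. Eigenvalues are then recognised as the numbers with an eigenspace of
  positive dimension.\<close>

lemma orthogonal_conj_eigen:
  fixes C Q :: "real^'n^'n"
  assumes Q: "orthogonal_matrix Q"
  shows "eigvals (transpose Q ** C ** Q) = eigvals C" "eig_mult (transpose Q ** C ** Q) c = eig_mult C c"
proof -
  have inv: "transpose Q ** Q = mat 1" "Q ** transpose Q = mat 1"
    using Q by (simp_all add: orthogonal_matrix_def)
  have inj: "inj ((*v) (transpose Q))"
    by (rule inj_on_inverseI[of _ "(*v) Q"]) (simp add: matrix_vector_mul_assoc inv del: transpose_matrix_vector)
  have sp: "{v. (transpose Q ** C ** Q) *v v = c *\<^sub>R v} = (*v) (transpose Q) ` {v. C *v v = c *\<^sub>R v}" for c
  proof (intro equalityI subsetI)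
    fix v assume "v \<in> {v. (transpose Q ** C ** Q) *v v = c *\<^sub>R v}"
    then have "Q *v ((transpose Q ** C ** Q) *v v) = c *\<^sub>R (Q *v v)"
      by (simp add: matrix_vector_mult_scaleR)
    then have "C *v (Q *v v) = c *\<^sub>R (Q *v v)"
      by (simp add: matrix_vector_mul_assoc matrix_mul_assoc inv del: transpose_matrix_vector)
    moreover have "v = transpose Q *v (Q *v v)"
      by (simp add: matrix_vector_mul_assoc inv del: transpose_matrix_vector)
    ultimately show "v \<in> (*v) (transpose Q) ` {v. C *v v = c *\<^sub>R v}" by blast
  next
    fix v assume "v \<in> (*v) (transpose Q) ` {v. C *v v = c *\<^sub>R v}"
    then obtain w where w: "v = transpose Q *v w" "C *v w = c *\<^sub>R w" by blast
    have "(transpose Q ** C ** Q) *v v = transpose Q *v (C *v ((Q ** transpose Q) *v w))"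
      unfolding w(1) by (simp only: matrix_vector_mul_assoc matrix_mul_assoc)
    also have "\<dots> = c *\<^sub>R v"
      by (simp add: inv w matrix_vector_mult_scaleR del: transpose_matrix_vector)
    finally show "v \<in> {v. (transpose Q ** C ** Q) *v v = c *\<^sub>R v}" by simp
  qed
  show mult: "eig_mult (transpose Q ** C ** Q) c = eig_mult C c" for c
    unfolding eig_mult_def sp
    by (rule dim_image_eq) (use inj in \<open>auto intro: inj_on_subset\<close>)
  have "c \<in> eigvals (transpose Q ** C ** Q) \<longleftrightarrow> c \<in> eigvals C" for c
  proof -
    have "c \<in> eigvals B \<longleftrightarrow> \<not> {v. B *v v = c *\<^sub>R v} \<subseteq> {0}" for B :: "real^'n^'n"
      by (auto simp: eigvals_def)
    then show ?thesis
      using mult[of c] by (simp only: eig_mult_def dim_eq_0[symmetric])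
  qed
  then show "eigvals (transpose Q ** C ** Q) = eigvals C" by blast
qed

lemma sorted_list_of_set_image:
  assumes "finite E" "strict_mono_on E f"
  shows "sorted_list_of_set (f ` E) = map f (sorted_list_of_set E)"
proof (rule sorted_distinct_set_unique)
  have "sorted_wrt (\<lambda>x y. f x \<le> f y) (sorted_list_of_set E)"
    by (rule sorted_wrt_mono_rel[OF _ sorted_sorted_list_of_set])
      (use assms in \<open>auto simp: strict_mono_on_def le_less\<close>)
  then show "sorted (map f (sorted_list_of_set E))"
    by (simp add: sorted_wrt_map)
qed (use assms strict_mono_on_imp_inj_on in \<open>auto simp: distinct_map\<close>)

text \<open>Eigenvectors for distinct eigenvalues are orthogonal, hence independent. The bound keeps
  the exponents occurring in \<open>Psi_M\<close> within the range of the trace conditions of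
  \<open>SMP\<close>.\<close>

lemma card_eigvals_le:
  fixes A :: "real^'n^'n"
  assumes A: "sym_mat A"
  shows "card (eigvals A) \<le> CARD('n)"
proof -
  have "\<forall>c\<in>eigvals A. \<exists>v. v \<noteq> 0 \<and> A *v v = c *\<^sub>R v"
    by (simp add: eigvals_def)
  then obtain g where g: "\<And>c. c \<in> eigvals A \<Longrightarrow> g c \<noteq> 0 \<and> A *v g c = c *\<^sub>R g c"
    by metis
  have orth: "g c \<bullet> g d = 0" if c: "c \<in> eigvals A" and d: "d \<in> eigvals A" and ne: "c \<noteq> d" for c d
  proof -
    have "c * (g c \<bullet> g d) = d * (g c \<bullet> g d)"
      using sym_mat_dot[OF A, of "g c" "g d"] g[OF c] g[OF d] by simp
    then show ?thesis using ne by simp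
  qed
  have "inj_on g (eigvals A)"
    using orth g by (metis inj_onI inner_eq_zero_iff)
  moreover have "independent (g ` eigvals A)"
    using orth g by (intro pairwise_orthogonal_independent) (auto simp: pairwise_def orthogonal_def)
  ultimately show ?thesis
    using independent_bound[of "g ` eigvals A"] by (simp add: card_image)
qed

subsection \<open>Perturbation to a prescribed pattern\<close>

text \<open>Turns orthogonality of matrices into a linear relation among the coordinates in
  \<open>N\<close>; the factor 2 counts the mirrored lower triangle.\<close>

lemma inner_sym_mat:
  fixes X Y :: "real^'n::{finite,linorder}^'n::{finite,linorder}"
  assumes X: "sym_mat X" and Y: "sym_mat Y" and N: "N \<subseteq> {(i, j). i < j}"
    and diag: "\<And>i. X $ i $ i = 0" and off: "\<And>p. p \<in> {(i, j). i < j} - N \<Longrightarrow> vec_coord X p = 0"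
  shows "X \<bullet> Y = 2 * (\<Sum>p\<in>N. vec_coord X p * vec_coord Y p)"
proof -
  let ?f = "\<lambda>p. vec_coord X p * vec_coord Y p"
  let ?U = "{(i, j). i < j} :: ('n \<times> 'n) set" and ?D = "{(i, j). i > j} :: ('n \<times> 'n) set"
  have "X \<bullet> Y = (\<Sum>p\<in>UNIV. ?f p)"
    by (simp add: inner_vec_def sum.cartesian_product vec_coord_def case_prod_unfold)
  also have "\<dots> = (\<Sum>p\<in>?U \<union> ?D. ?f p)"
    using diag by (intro sum.mono_neutral_right) (auto simp: vec_coord_def not_less_iff_gr_or_eq)
  also have "\<dots> = sum ?f ?U + sum ?f ?D"
    by (intro sum.union_disjoint) auto
  also have "sum ?f ?D = sum ?f ?U"
    by (rule sum.reindex_bij_witness[where i = prod.swap and j = prod.swap])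
      (auto simp: vec_coord_def sym_matD[OF X] sym_matD[OF Y])
  also have "sum ?f ?U = sum ?f N"
    using N off by (intro sum.mono_neutral_right) auto
  finally show ?thesis by simp
qed

lemma finite_pos_lower_bound:
  fixes f :: "'a \<Rightarrow> real"
  assumes "finite S" "\<And>s. s \<in> S \<Longrightarrow> f s > 0"
  shows "\<exists>\<delta>>0. \<forall>s\<in>S. \<delta> \<le> f s"
  using assms
proof (induction S rule: finite_induct)
  case empty
  show ?case by (rule exI[of _ 1]) simp
next
  case (insert a S)
  then obtain \<delta> where "\<delta> > 0" "\<forall>s\<in>S. \<delta> \<le> f s" by auto
  then show ?case using insert.prems[of a] by (intro exI[of _ "min \<delta> (f a)"]) auto
qed

lemma abs_entry_le_norm: "\<bar>M $ i $ j\<bar> \<le> norm (M :: real^'m^'n)"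
  using component_le_norm_cart[of "M $ i" j] Finite_Cartesian_Product.norm_nth_le[of M i] by linarith

text \<open>
  \<open>dir j\<close> is the direction in parameter space along which \<open>\<Phi>\<close> has the \<open>j\<close>-th column of the
  verification matrix as derivative; \<open>col j B\<close> is that column as a function of the matrix.
\<close>

lemma perturb_pattern:
  fixes G :: "'n::{finite,linorder} set set"
    and A :: "real^'n::{finite,linorder}^'n::{finite,linorder}"
    and M :: "('n \<times> 'n, 'c) imat"
    and \<Phi> :: "'w::real_normed_vector \<Rightarrow> real^'n::{finite,linorder}^'n::{finite,linorder}"
  assumes A: "A \<in> mats_of_graph G"
    and rows: "row_ix M = Ebar G" and fin: "finite (col_ix M)"
    and deriv: "(\<Phi> has_derivative L) (at 0)" and cont: "continuous_on UNIV \<Phi>"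
    and \<Phi>0: "\<Phi> 0 = A" and sym\<Phi>: "\<And>u. u \<in> span (dir ` col_ix M) \<Longrightarrow> sym_mat (\<Phi> u)"
    and dir: "\<And>j p. j \<in> col_ix M \<Longrightarrow> p \<in> Ebar G \<Longrightarrow> entry M p j = vec_coord (L (dir j)) p"
    and col: "\<And>j p. j \<in> col_ix M \<Longrightarrow> p \<in> Ebar G \<Longrightarrow> entry M p j = vec_coord (col j A) p"
      "\<And>j. j \<in> col_ix M \<Longrightarrow> isCont (col j) A"
      "\<And>j B. sym_mat B \<Longrightarrow> sym_mat (col j B)"
    and x: "x \<in> column_space M" "rows_independent M (Ebar G - supp x)"
    and e: "\<epsilon> > 0"
  shows "\<exists>u\<in>span (dir ` col_ix M). norm u < \<epsilon> \<and> dist (\<Phi> u) A < \<epsilon> \<and>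
           \<Phi> u \<in> mats_of_graph (G \<union> supp_graph x) \<and>
           (\<forall>X. sym_mat X \<and> hadamard (\<Phi> u) X = 0 \<and> hadamard (mat 1) X = 0 \<and>
                (\<forall>j\<in>col_ix M. X \<bullet> col j (\<Phi> u) = 0) \<longrightarrow> X = 0)"
proof -
  define N where "N = Ebar G - supp x"
  interpret L: bounded_linear L
    using deriv by (rule has_derivative_bounded_linear)
  \<comment> \<open>The coefficients of \<open>x\<close> in the columns become the direction
    \<open>v = lin c0\<close>, along which the derivative has exactly the coordinates of
    \<open>x\<close> on \<open>Ebar G\<close>.\<close>
  obtain c0 where c0: "\<And>p. x $ p = (if p \<in> Ebar G then \<Sum>j\<in>col_ix M. c0 j * entry M p j else 0)"
    using column_space_coeffs[OF x(1) fin] rows by auto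
  have A_edge: "A $ i $ j = 0 \<longleftrightarrow> {i, j} \<notin> G" if "i \<noteq> j" for i j
    using A that unfolding mats_of_graph_def by blast
  have suppE: "supp x \<subseteq> Ebar G"
    using c0 by (auto simp: supp_def split: if_splits)
  have "\<forall>p\<in>N. \<exists>c. \<forall>p'\<in>N. (\<Sum>j\<in>col_ix M. c j * entry M p' j) = (if p' = p then 1 else 0)"
    using rows_independent_dual[OF x(2) _ fin] by (simp add: N_def)
  \<comment> \<open>Dual family to the rows in \<open>N\<close>. It serves twice: through
    \<open>R\<close> as a right inverse of the derivative on \<open>N\<close>, and through
    \<open>H\<close> as a witness of independence that persists near \<open>A\<close>.\<close>
  then obtain c where c: "\<And>p p'. p \<in> N \<Longrightarrow> p' \<in> N \<Longrightarrow>
      (\<Sum>j\<in>col_ix M. c p j * entry M p' j) = (if p' = p then 1 else 0)"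
    by metis
  define lin where "lin a = (\<Sum>j\<in>col_ix M. a j *\<^sub>R dir j)" for a
  have lin: "vec_coord (L (lin a)) p = (\<Sum>j\<in>col_ix M. a j * entry M p j)" if "p \<in> Ebar G" for a p
    using dir[OF _ that] by (simp add: lin_def L.sum L.scaleR vec_coord_def)
  have lin_span: "lin a \<in> span (dir ` col_ix M)" for a
    unfolding lin_def by (intro span_sum span_scale span_base) auto
  define v where "v = lin c0"
  define R where "R z = (\<Sum>p\<in>N. z $ p *\<^sub>R lin (c p))" for z :: "real^('n \<times> 'n)"
  define \<pi> where "\<pi> Y = (\<chi> p. if p \<in> N then vec_coord Y p else 0)"
    for Y :: "real^'n::{finite,linorder}^'n::{finite,linorder}"
  define P where "P z = (\<chi> p. if p \<in> N then z $ p else 0)" for z :: "real^('n \<times> 'n)"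
  have NE: "N \<subseteq> Ebar G" by (simp add: N_def)
  have lv: "vec_coord (L v) p = x $ p" if "p \<in> Ebar G" for p
    using that c0 lin by (simp add: v_def)
  have bl\<pi>: "bounded_linear \<pi>"
    unfolding linear_conv_bounded_linear[symmetric] \<pi>_def
    by (rule linearI) (auto simp: vec_eq_iff vec_coord_def)
  have A_E: "vec_coord A p = 0" if "p \<in> Ebar G" for p
    using that A_edge[of "fst p" "snd p"] by (auto simp: vec_coord_def Ebar_def graph_compl_def)
  have \<pi>A: "\<pi> (\<Phi> 0) = 0"
    using A_E NE by (auto simp: \<Phi>0 \<pi>_def vec_eq_iff)
  have PP: "P (P z) = P z" "P (\<pi> Y) = \<pi> Y" for z Y
    by (simp_all add: P_def \<pi>_def vec_eq_iff)
  have linP: "linear P"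
    unfolding P_def by (rule linearI) (auto simp: vec_eq_iff)
  have linR: "linear R"
    unfolding R_def by (rule linearI) (auto simp: sum.distrib scaleR_add_left scaleR_sum_right)
  have \<pi>LR: "\<pi> (L (R z)) = P z" for z
  proof -
    have "vec_coord (L (R z)) p = z $ p" if p: "p \<in> N" for p
    proof -
      have "vec_coord (L (R z)) p = (\<Sum>q\<in>N. z $ q * vec_coord (L (lin (c q))) p)"
        by (simp add: R_def L.sum L.scaleR vec_coord_def)
      also have "\<dots> = (\<Sum>q\<in>N. z $ q * (if q = p then 1 else 0))"
        using p NE by (intro sum.cong) (auto simp: lin c)
      also have "\<dots> = z $ p"
        using p by (simp add: if_distrib[of "\<lambda>b. _ * b"] cong: if_cong)
      finally show ?thesis .
    qed
    then show ?thesis by (simp add: \<pi>_def P_def vec_eq_iff)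
  qed
  have \<pi>v: "\<pi> (L v) = 0"
    using lv NE by (auto simp: \<pi>_def vec_eq_iff N_def supp_def)

  \<comment> \<open>The dual column combinations with \<open>B\<close> in place of \<open>A\<close>.
    At \<open>A\<close> their coordinates on \<open>N\<close> form the identity matrix; continuity
    keeps them within \<open>1 / (2 * (real (card N) + 1))\<close> of it, small enough for
    \<open>diag_dominant_kernel\<close> even if \<open>N\<close> is empty.\<close>
  define H where "H p B = (\<Sum>j\<in>col_ix M. c p j *\<^sub>R col j B)" for p B
  have "\<forall>p\<in>N. \<forall>\<^sub>F B in nhds A. dist (H p B) (H p A) < 1 / (2 * (real (card N) + 1))"
  proof
    fix p
    have "isCont (H p) A"
      unfolding H_def by (intro continuous_intros col(2))
    then have "((H p) \<longlongrightarrow> H p A) (nhds A)"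
      by (simp add: continuous_at flip: tendsto_at_iff_tendsto_nhds)
    then show "\<forall>\<^sub>F B in nhds A. dist (H p B) (H p A) < 1 / (2 * (real (card N) + 1))"
      by (rule tendstoD) simp
  qed
  then have "\<forall>\<^sub>F B in nhds A. \<forall>p\<in>N. dist (H p B) (H p A) < 1 / (2 * (real (card N) + 1))"
    by (simp add: eventually_ball_finite)
  then obtain \<delta>1 where \<delta>1: "\<delta>1 > 0" "\<And>B p. dist B A < \<delta>1 \<Longrightarrow> p \<in> N \<Longrightarrow>
      dist (H p B) (H p A) < 1 / (2 * (real (card N) + 1))"
    unfolding eventually_nhds_metric by blast
  \<comment> \<open>Entries on the edges of \<open>G\<close> stay nonzero under changes smaller than
    \<open>\<delta>2\<close>; \<open>\<delta>3\<close> below does the same for the coordinates of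
    \<open>x\<close> on its support.\<close>
  obtain \<delta>2 where \<delta>2: "\<delta>2 > 0" "\<And>i j. i \<noteq> j \<Longrightarrow> {i, j} \<in> G \<Longrightarrow> \<delta>2 \<le> \<bar>A $ i $ j\<bar>"
  proof -
    have "\<exists>\<delta>>0. \<forall>p\<in>{(i, j). i \<noteq> j \<and> {i, j} \<in> G}. \<delta> \<le> \<bar>vec_coord A p\<bar>"
      using A_edge by (intro finite_pos_lower_bound) (auto simp: vec_coord_def)
    then show ?thesis using that by (fastforce simp: vec_coord_def)
  qed
  obtain \<delta>3 where \<delta>3: "\<delta>3 > 0" "\<And>p. p \<in> supp x \<Longrightarrow> \<delta>3 \<le> \<bar>x $ p\<bar>"
    using finite_pos_lower_bound[of "supp x" "\<lambda>p. \<bar>x $ p\<bar>"] by (auto simp: supp_def)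
  \<comment> \<open>The halves turn the non-strict bounds of \<open>perturb_along_direction\<close>
    into strict ones: \<open>norm u < \<epsilon>\<close>, and an error below
    \<open>\<delta>3 * t\<close>.\<close>
  define \<mu> where "\<mu> = min (\<epsilon> / 2) (\<delta>3 / 2)"
  define \<delta> where "\<delta> = min \<epsilon> (min \<delta>1 \<delta>2)"
  have \<mu>: "\<mu> > 0" "\<mu> < \<epsilon>" "\<mu> < \<delta>3" using e \<delta>3 by (auto simp: \<mu>_def)
  have \<delta>: "\<delta> > 0" using e \<delta>1 \<delta>2 by (simp add: \<delta>_def)
  have "\<exists>t0>0. \<forall>t. 0 < t \<and> t < t0 \<longrightarrow>
           (\<exists>u. u \<in> span (insert v (range R)) \<and> \<pi> (\<Phi> u) = 0 \<and> norm u \<le> \<mu> \<and>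
                norm (\<Phi> u - \<Phi> 0 - t *\<^sub>R L v) \<le> \<mu> * t)"
    by (rule perturb_along_direction[OF deriv cont bl\<pi> \<pi>A linP PP linR \<pi>LR \<pi>v \<mu>(1)])
  then obtain t0 where t0: "t0 > 0" "\<And>t. 0 < t \<and> t < t0 \<Longrightarrow>
           (\<exists>u. u \<in> span (insert v (range R)) \<and> \<pi> (\<Phi> u) = 0 \<and> norm u \<le> \<mu> \<and>
                norm (\<Phi> u - \<Phi> 0 - t *\<^sub>R L v) \<le> \<mu> * t)"
    by blast
  define K where "K = norm (L v) + \<mu> + 1"
  have K: "K > 0" using \<mu> by (simp add: K_def add_nonneg_pos)
  define t where "t = min (t0 / 2) (\<delta> / (2 * K))"
  have t: "t > 0" "t < t0" "t * K < \<delta>"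
  proof -
    show "t > 0" "t < t0" using t0 \<delta> K by (auto simp: t_def)
    have "t * K \<le> \<delta> / (2 * K) * K" using K by (intro mult_right_mono) (auto simp: t_def)
    also have "\<dots> < \<delta>" using K \<delta> by simp
    finally show "t * K < \<delta>" .
  qed
  obtain u where u: "u \<in> span (insert v (range R))" "\<pi> (\<Phi> u) = 0" "norm u \<le> \<mu>"
      "norm (\<Phi> u - A - t *\<^sub>R L v) \<le> \<mu> * t"
    using t0(2)[of t] t \<Phi>0 by auto
  define B where "B = \<Phi> u"
  have u_span: "u \<in> span (dir ` col_ix M)"
  proof -
    have "insert v (range R) \<subseteq> span (dir ` col_ix M)"
      by (auto simp: v_def R_def lin_span intro!: span_sum span_scale)
    then show ?thesis using u(1) by (metis span_mono span_span subsetD)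
  qed
  have symB: "sym_mat B" using sym\<Phi>[OF u_span] by (simp add: B_def)
  have distB: "dist B A < \<delta>"
  proof -
    have "norm (B - A) \<le> norm (t *\<^sub>R L v) + norm (B - A - t *\<^sub>R L v)"
      using norm_triangle_sub[of "B - A" "t *\<^sub>R L v"] by simp
    also have "\<dots> \<le> t * norm (L v) + \<mu> * t" using u(4) t by (simp add: B_def)
    also have "\<dots> \<le> t * K" using t by (simp add: K_def algebra_simps)
    finally show ?thesis using t by (simp add: dist_norm)
  qed
  have B_N: "vec_coord B p = 0" if "p \<in> N" for p
  proof -
    have "\<pi> B $ p = 0" using u(2) by (simp add: B_def)
    then show ?thesis using that by (simp add: \<pi>_def)
  qed
  have B_G: "B $ i $ j \<noteq> 0" if "i \<noteq> j" "{i, j} \<in> G" for i j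
  proof -
    have "\<bar>(B - A) $ i $ j\<bar> < \<delta>2"
      using abs_entry_le_norm[of "B - A" i j] distB by (simp add: dist_norm \<delta>_def)
    then show ?thesis using \<delta>2(2)[OF that] by auto
  qed
  \<comment> \<open>Here \<open>A\<close> vanishes, so the entry of \<open>B\<close> is
    \<open>t * x $ p\<close> up to an error smaller than
    \<open>\<bar>t * x $ p\<bar>\<close>.\<close>
  have B_x: "vec_coord B p \<noteq> 0" if p: "p \<in> supp x" for p
  proof -
    have "vec_coord A p = 0"
      using A_E suppE p by blast
    then have "\<bar>vec_coord B p - t * x $ p\<bar> \<le> \<mu> * t"
      using order_trans[OF abs_entry_le_norm[of "B - A - t *\<^sub>R L v" "fst p" "snd p"] u(4)[folded B_def]]
        lv[of p] p suppE by (auto simp: vec_coord_def)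
    also have "\<dots> < \<delta>3 * t" using \<mu> t by simp
    also have "\<dots> \<le> \<bar>x $ p\<bar> * t" using \<delta>3(2)[OF p] t by simp
    also have "\<dots> = \<bar>t * x $ p\<bar>" using t by (simp add: abs_mult)
    finally show ?thesis by auto
  qed
  \<comment> \<open>\<open>supp_graph\<close> forgets the order of a pair, but the support of
    \<open>x\<close> contains only increasing pairs, so the edge determines the index.\<close>
  have supp_edge: "{i, j} \<in> supp_graph x \<longleftrightarrow> (i, j) \<in> supp x" if "i < j" for i j
    using suppE that by (fastforce simp: supp_graph_def Ebar_def doubleton_eq_iff)
  have edge: "B $ i $ j \<noteq> 0 \<longleftrightarrow> {i, j} \<in> G \<union> supp_graph x" if ij: "i < j" for i j
  proof (cases "{i, j} \<in> G")
    case True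
    then show ?thesis using B_G ij by auto
  next
    case False
    then have "(i, j) \<in> Ebar G" using ij by (auto simp: Ebar_def graph_compl_def all_edges_def)
    then show ?thesis
      using B_N[of "(i, j)"] B_x[of "(i, j)"] False supp_edge[OF ij]
      by (auto simp: N_def vec_coord_def)
  qed
  have B_graph: "B \<in> mats_of_graph (G \<union> supp_graph x)"
  proof -
    have "B $ i $ j \<noteq> 0 \<longleftrightarrow> {i, j} \<in> G \<union> supp_graph x" if "i \<noteq> j" for i j
      using edge[of i j] edge[of j i] that sym_matD[OF symB, of i j]
      by (cases i j rule: linorder_cases) (simp_all add: insert_commute)
    then show ?thesis using symB by (simp add: mats_of_graph_def)
  qed
  \<comment> \<open>Above the diagonal \<open>B\<close> is nonzero off \<open>N\<close>, so
    \<open>X\<close> lives on \<open>N\<close> and its mirror image. Orthogonality to the columns at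
    \<open>B\<close> then puts its coordinates in the kernel of the near-identity matrix given by
    \<open>H\<close>.\<close>
  have strong: "X = 0" if X: "sym_mat X" "hadamard B X = 0" "hadamard (mat 1) X = 0"
      and orth: "\<And>j. j \<in> col_ix M \<Longrightarrow> X \<bullet> col j B = 0" for X
  proof -
    have diag: "X $ i $ i = 0" for i
    proof -
      have "hadamard (mat 1) X $ i $ i = 0" using X(3) by simp
      then show ?thesis by (simp add: hadamard_def mat_def)
    qed
    have BX: "B $ i $ j * X $ i $ j = 0" for i j
      using X(2) by (simp add: hadamard_def vec_eq_iff)
    have off: "vec_coord X p = 0" if "p \<in> {(i, j). i < j} - N" for p
    proof -
      obtain i j where p: "p = (i, j)" "i < j" "(i, j) \<notin> N" using \<open>p \<in> _\<close> by (cases p) auto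
      have "B $ i $ j \<noteq> 0"
      proof (cases "{i, j} \<in> G")
        case True
        then show ?thesis using B_G p by auto
      next
        case False
        then have "(i, j) \<in> Ebar G" using p by (auto simp: Ebar_def graph_compl_def all_edges_def)
        then show ?thesis using B_x[of "(i, j)"] p by (simp add: N_def vec_coord_def)
      qed
      then show ?thesis using BX[of i j] p by (simp add: vec_coord_def)
    qed
    have NU: "N \<subseteq> {(i, j). i < j}" using NE by (auto simp: Ebar_def)
    have "\<forall>p\<in>N. vec_coord X p = 0"
    proof (rule diag_dominant_kernel)
      show "finite N" by simp
      show "\<bar>vec_coord (H p B) p' - (if p' = p then 1 else 0)\<bar> \<le> 1 / (2 * (real (card N) + 1))"
        if p: "p \<in> N" "p' \<in> N" for p p'
      proof -
        have "vec_coord (H p A) p' = (\<Sum>j\<in>col_ix M. c p j * entry M p' j)"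
          using p(2) NE by (auto simp: H_def vec_coord_def col(1) intro!: sum.cong)
        then have "vec_coord (H p B) p' - (if p' = p then 1 else 0) = vec_coord (H p B - H p A) p'"
          using c[OF p] by (simp add: vec_coord_def)
        also have "\<bar>\<dots>\<bar> \<le> dist (H p B) (H p A)"
          unfolding vec_coord_def dist_norm by (rule abs_entry_le_norm)
        finally show ?thesis using \<delta>1(2)[of B p] distB p by (simp add: \<delta>_def)
      qed
      show "real (card N) * (1 / (2 * (real (card N) + 1))) < 1" by (simp add: field_simps)
      show "(\<Sum>p'\<in>N. vec_coord X p' * vec_coord (H p B) p') = 0" if "p \<in> N" for p
      proof -
        \<comment> \<open>One relation per column; weighting them by \<open>c p\<close> and
          exchanging the sums produces \<open>H p B\<close>.\<close>
        have "(\<Sum>p'\<in>N. vec_coord X p' * vec_coord (col j B) p') = 0" if "j \<in> col_ix M" for j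
          using inner_sym_mat[OF X(1) col(3)[OF symB, of j] NU diag off] orth[OF that] by simp
        then have "(\<Sum>j\<in>col_ix M. c p j * (\<Sum>p'\<in>N. vec_coord X p' * vec_coord (col j B) p')) = 0"
          by simp
        also have "(\<Sum>j\<in>col_ix M. c p j * (\<Sum>p'\<in>N. vec_coord X p' * vec_coord (col j B) p')) =
            (\<Sum>j\<in>col_ix M. \<Sum>p'\<in>N. vec_coord X p' * (c p j * vec_coord (col j B) p'))"
          by (simp add: sum_distrib_left mult.left_commute)
        also have "\<dots> = (\<Sum>p'\<in>N. \<Sum>j\<in>col_ix M. vec_coord X p' * (c p j * vec_coord (col j B) p'))"
          by (rule sum.swap)
        also have "\<dots> = (\<Sum>p'\<in>N. vec_coord X p' * vec_coord (H p B) p')"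
          by (simp add: H_def vec_coord_def sum_distrib_left)
        finally show ?thesis .
      qed
    qed
    then have up: "X $ i $ j = 0" if "i < j" for i j
      using off[of "(i, j)"] that by (cases "(i, j) \<in> N") (auto simp: vec_coord_def)
    have "X $ i $ j = 0" for i j
      using up[of i j] up[of j i] diag[of i] sym_matD[OF X(1), of i j]
      by (cases i j rule: linorder_cases) auto
    then show "X = 0" by (simp add: vec_eq_iff)
  qed
  show ?thesis
    using u_span u(3) \<mu>(2) distB B_graph strong
    by (intro bexI[of _ u]) (auto simp: B_def \<delta>_def)
qed

subsection \<open>Multiplicities under perturbation\<close>

lemma bounded_bilinear_matrix_vector_mult:
  "bounded_bilinear ((*v) :: real^'n^'m \<Rightarrow> real^'n \<Rightarrow> real^'m)"
  unfolding bilinear_conv_bounded_bilinear[symmetric] bilinear_def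
  by (intro conjI allI linearI)
    (simp_all add: matrix_vector_mult_def vec_eq_iff sum.distrib algebra_simps sum_distrib_left)

text \<open>Applying \<open>D\<close> to an eigenvector bounds the shift
  \<open>\<bar>f c\<bar>\<close> by a multiple of \<open>norm D\<close>. Shifts below half the
  smallest gap \<open>\<gamma>\<close> between eigenvalues can neither swap nor merge them.\<close>

lemma strict_mono_on_perturbed_eigvals:
  fixes A :: "real^'n^'n"
  assumes A: "sym_mat A"
  shows "\<exists>\<delta>>0. \<forall>D f. norm D < \<delta> \<and> (\<forall>c v. A *v v = c *\<^sub>R v \<longrightarrow> D *v v = f c *\<^sub>R v) \<longrightarrow>
           strict_mono_on (eigvals A) (\<lambda>c. c + f c)"
proof -
  obtain C where C: "C > 0" "\<And>(D::real^'n^'n) v. norm (D *v v) \<le> norm D * norm v * C"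
    using bounded_bilinear.pos_bounded[OF bounded_bilinear_matrix_vector_mult] by blast
  have "\<exists>\<gamma>>0. \<forall>p\<in>{(c, d). c \<in> eigvals A \<and> d \<in> eigvals A \<and> c < d}. \<gamma> \<le> snd p - fst p"
    by (rule finite_pos_lower_bound)
      (auto intro: finite_subset[OF _ finite_cartesian_product[OF finite_eigvals[OF A] finite_eigvals[OF A]]])
  then obtain \<gamma> where \<gamma>: "\<gamma> > 0" "\<And>c d. c \<in> eigvals A \<Longrightarrow> d \<in> eigvals A \<Longrightarrow> c < d \<Longrightarrow> \<gamma> \<le> d - c"
    by fastforce
  show ?thesis
  proof (intro exI[of _ "\<gamma> / (2 * C)"] conjI allI impI; (elim conjE)?)
    show "\<gamma> / (2 * C) > 0" using \<gamma> C by simp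
    fix D :: "real^'n^'n" and f
    assume D: "norm D < \<gamma> / (2 * C)" and f: "\<forall>c v. A *v v = c *\<^sub>R v \<longrightarrow> D *v v = f c *\<^sub>R v"
    have small: "\<bar>f c\<bar> < \<gamma> / 2" if c: "c \<in> eigvals A" for c
    proof -
      obtain v where v: "v \<noteq> 0" "A *v v = c *\<^sub>R v" using c by (auto simp: eigvals_def)
      have "D *v v = f c *\<^sub>R v" using f v(2) by blast
      then have "\<bar>f c\<bar> * norm v = norm (D *v v)" by simp
      also have "\<dots> \<le> (norm D * C) * norm v" using C(2)[of D v] by (simp add: mult_ac)
      finally have "\<bar>f c\<bar> \<le> norm D * C" using v(1) by simp
      also have "\<dots> < \<gamma> / 2" using D C(1) by (simp add: field_simps)
      finally show ?thesis .
    qed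
    show "strict_mono_on (eigvals A) (\<lambda>c. c + f c)"
    proof (rule strict_mono_onI)
      fix c d assume cd: "c \<in> eigvals A" "d \<in> eigvals A" "c < d"
      show "c + f c < d + f d"
        using \<gamma>(2)[OF cd] small[OF cd(1)] small[OF cd(2)] by linarith
    qed
  qed
qed

text \<open>Adding \<open>D\<close> moves each eigenspace as a whole from \<open>c\<close> to
  \<open>c + f c\<close> in the same order, and conjugation by \<open>Q\<close> changes neither
  eigenvalues nor multiplicities.\<close>

lemma ordered_mult_list_perturbed:
  assumes A: "sym_mat A" and D: "sym_mat D" and Q: "orthogonal_matrix Q"
    and f: "\<And>c v. A *v v = c *\<^sub>R v \<Longrightarrow> D *v v = f c *\<^sub>R v"
    and mono: "strict_mono_on (eigvals A) (\<lambda>c. c + f c)"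
  shows "ordered_mult_list (transpose Q ** (A + D) ** Q) = ordered_mult_list A"
proof -
  have symAD: "sym_mat (A + D)" using A D by (simp add: sym_mat_def transpose_add)
  have fAD: "(A + D) *v v = (c + f c) *\<^sub>R v" if "A *v v = c *\<^sub>R v" for c v
    using f[OF that] that by (simp add: matrix_vector_mult_add_rdistrib scaleR_left_distrib)
  note E = eigenspaces_of_function[OF A symAD fAD strict_mono_on_imp_inj_on[OF mono]]
  have "map (eig_mult (A + D)) (sorted_list_of_set (eigvals (A + D))) =
      map (\<lambda>c. eig_mult (A + D) (c + f c)) (sorted_list_of_set (eigvals A))"
    by (simp add: E(1) sorted_list_of_set_image[OF finite_eigvals[OF A] mono])
  also have "\<dots> = map (eig_mult A) (sorted_list_of_set (eigvals A))"
    using finite_eigvals[OF A] E(2) by (intro map_cong) auto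
  finally show ?thesis
    by (simp add: ordered_mult_list_def orthogonal_conj_eigen[OF Q] cong: map_cong)
qed

subsection \<open>Congruence, powers and inner products\<close>

text \<open>The parameter is a pair: \<open>fst w\<close> moves \<open>A\<close> by congruence and
  \<open>snd w\<close> is the added matrix. On the first component the derivative has the shape of
  the columns of the verification matrices.\<close>

lemma congruence_derivative:
  fixes A :: "real^'n^'n" and Q :: "real^'n^'n \<Rightarrow> real^'n^'n"
  assumes Q: "(Q has_derivative q) (at 0)" "Q 0 = mat 1"
  shows "((\<lambda>w. transpose (Q (fst w)) ** (A + snd w) ** Q (fst w)) has_derivative
          (\<lambda>w. A ** q (fst w) + snd w + transpose (q (fst w)) ** A)) (at 0)"
proof -
  have Qf: "((\<lambda>w. Q (fst w)) has_derivative (\<lambda>w. q (fst w))) (at (0 :: (real^'n^'n) \<times> (real^'n^'n)))"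
    by (rule has_derivative_compose[OF has_derivative_fst[OF has_derivative_ident]]) (simp add: Q)
  have "((\<lambda>w. A + snd w) has_derivative (\<lambda>w. 0 + snd w)) (at (0 :: (real^'n^'n) \<times> (real^'n^'n)))"
    by (intro has_derivative_add has_derivative_const has_derivative_snd has_derivative_ident)
  from matrix_mult.FDERIV[OF matrix_mult.FDERIV[OF bounded_linear.has_derivative[OF bounded_linear_transpose Qf] this] Qf]
  show ?thesis
    by (rule has_derivative_eq_rhs) (simp add: Q(2) fun_eq_iff matrix_mult.add_left)
qed

lemma continuous_on_congruence:
  fixes A :: "real^'n^'n" and Q :: "real^'n^'n \<Rightarrow> real^'n^'n"
  assumes "continuous_on UNIV Q"
  shows "continuous_on UNIV (\<lambda>w. transpose (Q (fst w)) ** (A + snd w) ** Q (fst w))"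
  by (intro matrix_mult.continuous_on bounded_linear.continuous_on[OF bounded_linear_transpose]
      continuous_on_compose2[OF assms] continuous_intros) auto

lemma sym_mat_congruence: "sym_mat A \<Longrightarrow> sym_mat (transpose Q ** A ** Q)"
  for A Q :: "real^'n^'n"
  by (simp add: sym_mat_def matrix_transpose_mul matrix_mul_assoc)

lemma sym_mat_add: "sym_mat A \<Longrightarrow> sym_mat B \<Longrightarrow> sym_mat (A + B)" for A B :: "real^'n^'n"
  by (simp add: sym_mat_def transpose_add)

lemma sym_mat_plus_transpose:
  "sym_mat B \<Longrightarrow> sym_mat (B ** K + transpose K ** B)" for B K :: "real^'n^'n"
  by (simp add: sym_mat_def transpose_add matrix_transpose_mul add.commute)

section \<open>Powers of a matrix\<close>

lemma mat_pow_commute: "A ** mat_pow A k = mat_pow A k ** A"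
  by (induction k) (simp_all add: matrix_mul_assoc)

lemma sym_mat_pow: "sym_mat A \<Longrightarrow> sym_mat (mat_pow A k)"
proof (induction k)
  case (Suc k)
  then show ?case by (simp add: sym_mat_def matrix_transpose_mul mat_pow_commute)
qed (simp add: sym_mat_def)

lemma mat_pow_eigenvector: "A *v v = c *\<^sub>R v \<Longrightarrow> mat_pow A k *v v = c ^ k *\<^sub>R v"
  for A :: "real^'n^'n"
  by (induction k) (simp_all add: matrix_vector_mult_scaleR mult.commute flip: matrix_vector_mul_assoc)

lemma isCont_mat_pow: "isCont (\<lambda>B. mat_pow B k) (A :: real^'n^'n)"
  by (induction k) (simp_all add: matrix_mult.continuous)

section \<open>Inner products with the columns of the verification matrices\<close>

lemma transpose_unit_mat: "transpose (unit_mat k l) = unit_mat l k"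
  by (auto simp: transpose_def unit_mat_def vec_eq_iff)

lemma transpose_skew_mat: "transpose (skew_mat k l) = skew_mat l k"
  by (simp add: skew_mat_def transpose_diff transpose_unit_mat)

lemma inner_unit_mat: "M \<bullet> unit_mat k l = M $ k $ l"
proof -
  have "unit_mat k l = axis k (axis l 1)"
    by (simp add: unit_mat_def axis_def vec_eq_iff)
  then show ?thesis by (simp add: inner_axis)
qed

lemma inner_matrix_mult_left: "X \<bullet> (Y ** Z) = (transpose Y ** X) \<bullet> Z"
  for X :: "real^'p^'m" and Y :: "real^'n^'m" and Z :: "real^'p^'n"
proof -
  have "X \<bullet> (Y ** Z) = (\<Sum>i\<in>UNIV. \<Sum>j\<in>UNIV. \<Sum>k\<in>UNIV. X $ i $ j * (Y $ i $ k * Z $ k $ j))"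
    by (simp add: inner_vec_def matrix_matrix_mult_def sum_distrib_left)
  also have "\<dots> = (\<Sum>k\<in>UNIV. \<Sum>j\<in>UNIV. \<Sum>i\<in>UNIV. X $ i $ j * (Y $ i $ k * Z $ k $ j))"
    by (subst sum.swap, subst (2) sum.swap, subst sum.swap) (rule refl)
  also have "\<dots> = (transpose Y ** X) \<bullet> Z"
    by (simp add: inner_vec_def matrix_matrix_mult_def transpose_def sum_distrib_left sum_distrib_right mult_ac)
  finally show ?thesis .
qed

lemma inner_transpose: "transpose X \<bullet> transpose Y = X \<bullet> Y" for X Y :: "real^'n^'m"
  by (simp add: inner_vec_def transpose_def) (rule sum.swap)

text \<open>The two summands are transposes of each other, so a symmetric \<open>X\<close> pairs
  equally with both. Orthogonality to the columns thus becomes a statement about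
  \<open>B ** X\<close>.\<close>

lemma inner_sym_variation:
  fixes X B K :: "real^'n^'n"
  assumes X: "sym_mat X" and B: "sym_mat B"
  shows "X \<bullet> (B ** K + transpose K ** B) = 2 * ((B ** X) \<bullet> K)"
proof -
  have "X \<bullet> (transpose K ** B) = transpose X \<bullet> transpose (transpose K ** B)"
    by (simp only: inner_transpose)
  also have "\<dots> = X \<bullet> (B ** K)"
    using X B by (simp add: matrix_transpose_mul sym_mat_def)
  finally show ?thesis
    using B by (simp add: inner_add_right inner_matrix_mult_left sym_mat_def)
qed

text \<open>A vanishing commutator makes \<open>B ** X\<close> symmetric, and symmetric matrices are
  orthogonal to skew-symmetric ones.\<close>

lemma inner_skew_mat:
  assumes "sym_mat X" "sym_mat B" "commutator B X = 0"
  shows "(B ** X) \<bullet> skew_mat k l = 0"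
proof -
  have "transpose (B ** X) = B ** X"
    using assms by (simp add: matrix_transpose_mul sym_mat_def commutator_def)
  then have "(B ** X) $ k $ l = (B ** X) $ l $ k"
    by (intro sym_matD) (simp add: sym_mat_def)
  then show ?thesis by (simp add: skew_mat_def inner_diff_right inner_unit_mat)
qed

text \<open>Supplies orthogonality to the powers 0 and 1, whose exponents lie below the trace
  conditions of \<open>SMP\<close>.\<close>

lemma inner_hadamard: "hadamard B X = 0 \<Longrightarrow> X \<bullet> B = 0" for X B :: "real^'n^'n"
proof -
  assume "hadamard B X = 0"
  then have "X $ i $ j * B $ i $ j = 0" for i j
    by (simp add: hadamard_def vec_eq_iff) blast
  then show ?thesis by (simp only: inner_vec_def inner_real_def sum.neutral_const)
qed

lemma inner_eq_trace: "sym_mat X \<Longrightarrow> X \<bullet> B = trace (B ** X)" for X B :: "real^'n^'n"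
  by (simp add: inner_vec_def trace_def matrix_matrix_mult_def sym_matD[of X] mult.commute)

section \<open>Invertibility and rank\<close>

lemma invertible_near_identity:
  "\<exists>\<delta>>0. \<forall>K :: real^'n^'n. norm K < \<delta> \<longrightarrow> invertible (mat 1 + K)"
proof -
  obtain C where C: "C > 0" "\<And>(D::real^'n^'n) v. norm (D *v v) \<le> norm D * norm v * C"
    using bounded_bilinear.pos_bounded[OF bounded_bilinear_matrix_vector_mult] by blast
  have "invertible (mat 1 + K)" if K: "norm K < 1 / C" for K :: "real^'n^'n"
  proof -
    have "v = 0" if "(mat 1 + K) *v v = 0" for v
    proof (rule ccontr)
      assume nz: "v \<noteq> 0"
      have "v = - (K *v v)"
        using that by (simp add: matrix_vector_mult_add_rdistrib add_eq_0_iff)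
      then have "norm v = norm (K *v v)" by (metis norm_minus_cancel)
      also have "\<dots> \<le> (norm K * C) * norm v" using C(2)[of K v] by (simp add: mult_ac)
      also have "\<dots> < 1 * norm v" using K C(1) nz by (intro mult_strict_right_mono) (auto simp: field_simps)
      finally show False by simp
    qed
    then show ?thesis by (simp add: invertible_left_inverse matrix_left_invertible_ker)
  qed
  then show ?thesis using C(1) by (intro exI[of _ "1 / C"]) auto
qed

text \<open>Products cannot raise the rank, and the congruence is undone by the inverse of
  \<open>Q\<close>.\<close>

lemma rank_congruence:
  fixes A Q :: "real^'n^'n"
  assumes "invertible Q"
  shows "rank (transpose Q ** A ** Q) = rank A"
proof -
  obtain R where R: "Q ** R = mat 1" "R ** Q = mat 1" using assms by (auto simp: invertible_def)
  have "transpose R ** (transpose Q ** A ** Q) ** R = transpose (Q ** R) ** A ** (Q ** R)"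
    by (simp only: matrix_transpose_mul matrix_mul_assoc)
  then have "A = transpose R ** (transpose Q ** A ** Q) ** R" by (simp add: R)
  then have "rank A \<le> rank (transpose Q ** A ** Q)"
    by (metis order_trans rank_mul_le_left rank_mul_le_right)
  moreover have "rank (transpose Q ** A ** Q) \<le> rank A"
    by (metis order_trans rank_mul_le_left rank_mul_le_right)
  ultimately show ?thesis by simp
qed

subsection \<open>The three cases\<close>

text \<open>Ensures that for the SSP and the SAP nothing is added to \<open>A\<close>, so that
  \<open>\<Phi>\<close> is a pure congruence.\<close>

lemma snd_span_zero:
  assumes "w \<in> span (dir ` J)" "\<And>j. j \<in> J \<Longrightarrow> snd (dir j) = 0"
  shows "snd w = 0"
proof -
  have "subspace {w. snd w = 0}" by (auto simp: subspace_def)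
  then show ?thesis using span_minimal[of "dir ` J" "{w. snd w = 0}"] assms by blast
qed

lemma perturbable_SSP:
  fixes G :: "'n::{finite,linorder} set set"
    and A :: "real^'n::{finite,linorder}^'n::{finite,linorder}"
  assumes A: "A \<in> mats_of_graph G"
    and x: "x \<in> column_space (Psi_S G A)" "rows_independent (Psi_S G A) (Ebar G - supp x)"
  shows "perturbable_to A (\<lambda>A'. A' \<in> mats_of_graph (G \<union> supp_graph x) \<and>
           SSP A' \<and> spectrum A' = spectrum A)"
  unfolding perturbable_to_def
proof (intro allI impI)
  fix \<epsilon> :: real assume e: "\<epsilon> > 0"
  have symA: "sym_mat A" using A by (simp add: mats_of_graph_def)
  define dir where "dir = (\<lambda>(k, l). (skew_mat k l :: real^'n::{finite,linorder}^'n::{finite,linorder}, 0 :: real^'n::{finite,linorder}^'n::{finite,linorder}))"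
  define col where "col = (\<lambda>(k, l) (B :: real^'n::{finite,linorder}^'n::{finite,linorder}). B ** skew_mat k l + skew_mat l k ** B)"
  define \<Phi> where "\<Phi> w = transpose (cayley (fst w)) ** (A + snd w) ** cayley (fst w)" for w
  have snd0: "snd u = 0" if "u \<in> span (dir ` col_ix (Psi_S G A))" for u
    using that by (rule snd_span_zero) (auto simp: dir_def)
  have "\<exists>u\<in>span (dir ` col_ix (Psi_S G A)). norm u < \<epsilon> \<and> dist (\<Phi> u) A < \<epsilon> \<and>
      \<Phi> u \<in> mats_of_graph (G \<union> supp_graph x) \<and>
      (\<forall>X. sym_mat X \<and> hadamard (\<Phi> u) X = 0 \<and> hadamard (mat 1) X = 0 \<and>
           (\<forall>j\<in>col_ix (Psi_S G A). X \<bullet> col j (\<Phi> u) = 0) \<longrightarrow> X = 0)"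
  proof (rule perturb_pattern[OF A _ _ _ _ _ _ _ _ _ _ x e])
    show "row_ix (Psi_S G A) = Ebar G" "finite (col_ix (Psi_S G A))"
      by (simp_all add: Psi_S_def)
    show "(\<Phi> has_derivative (\<lambda>w. A ** ((1 / 2) *\<^sub>R (fst w - transpose (fst w))) + snd w +
        transpose ((1 / 2) *\<^sub>R (fst w - transpose (fst w))) ** A)) (at 0)"
      unfolding \<Phi>_def[abs_def] by (rule congruence_derivative[OF cayley_derivative cayley_0])
    show "continuous_on UNIV \<Phi>"
      unfolding \<Phi>_def[abs_def] by (rule continuous_on_congruence[OF continuous_on_cayley])
    show "\<Phi> 0 = A" by (simp add: \<Phi>_def)
    show "sym_mat (\<Phi> u)" if "u \<in> span (dir ` col_ix (Psi_S G A))" for u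
      using snd0[OF that] by (simp add: \<Phi>_def sym_mat_congruence symA)
    \<comment> \<open>On skew-symmetric directions the derivative of \<open>cayley\<close> is the
      identity, which matches the column formula.\<close>
    have skew: "(1 / 2) *\<^sub>R (skew_mat k l - skew_mat l k) = (skew_mat k l :: real^'n::{finite,linorder}^'n::{finite,linorder})" for k l
      by (simp add: skew_mat_def vec_eq_iff)
    show "entry (Psi_S G A) p j = vec_coord (A ** ((1 / 2) *\<^sub>R (fst (dir j) - transpose (fst (dir j)))) +
        snd (dir j) + transpose ((1 / 2) *\<^sub>R (fst (dir j) - transpose (fst (dir j)))) ** A) p" for j p
      by (cases j) (simp add: dir_def Psi_S_def transpose_skew_mat skew)
    show "entry (Psi_S G A) p j = vec_coord (col j A) p" for j p
      by (cases j) (simp add: col_def Psi_S_def)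
    show "isCont (col j) A" for j
      by (cases j) (auto simp: col_def intro!: continuous_intros matrix_mult.continuous)
    show "sym_mat (col j B)" if "sym_mat B" for j B
      using sym_mat_plus_transpose[OF that, of "skew_mat (fst j) (snd j)"]
      by (cases j) (simp add: col_def transpose_skew_mat)
  qed
  then obtain u where u: "u \<in> span (dir ` col_ix (Psi_S G A))" "dist (\<Phi> u) A < \<epsilon>"
      "\<Phi> u \<in> mats_of_graph (G \<union> supp_graph x)"
      and strong: "\<And>X. sym_mat X \<Longrightarrow> hadamard (\<Phi> u) X = 0 \<Longrightarrow> hadamard (mat 1) X = 0 \<Longrightarrow>
           (\<And>j. j \<in> col_ix (Psi_S G A) \<Longrightarrow> X \<bullet> col j (\<Phi> u) = 0) \<Longrightarrow> X = 0" by blast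
  have sym\<Phi>: "sym_mat (\<Phi> u)" using u(3) by (simp add: mats_of_graph_def)
  have "SSP (\<Phi> u)"
    unfolding SSP_def
  proof (intro allI impI; elim conjE)
    fix X assume X: "sym_mat X" "hadamard (\<Phi> u) X = 0" "hadamard (mat 1) X = 0" "commutator (\<Phi> u) X = 0"
    show "X = 0"
    proof (rule strong[OF X(1-3)])
      fix j
      show "X \<bullet> col j (\<Phi> u) = 0"
        using inner_sym_variation[OF X(1) sym\<Phi>, of "skew_mat (fst j) (snd j)"]
          inner_skew_mat[OF X(1) sym\<Phi> X(4)]
        by (cases j) (simp add: col_def transpose_skew_mat)
    qed
  qed
  moreover have "spectrum (\<Phi> u) = spectrum A"
    using snd0[OF u(1)] by (simp add: \<Phi>_def spectrum_def orthogonal_conj_eigen[OF orthogonal_cayley])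
  ultimately show "\<exists>A'. dist A' A < \<epsilon> \<and> A' \<in> mats_of_graph (G \<union> supp_graph x) \<and>
      SSP A' \<and> spectrum A' = spectrum A"
    using u by blast
qed

lemma perturbable_SAP:
  fixes G :: "'n::{finite,linorder} set set"
    and A :: "real^'n::{finite,linorder}^'n::{finite,linorder}"
  assumes A: "A \<in> mats_of_graph G"
    and x: "x \<in> column_space (Psi_A G A)" "rows_independent (Psi_A G A) (Ebar G - supp x)"
  shows "perturbable_to A (\<lambda>A'. A' \<in> mats_of_graph (G \<union> supp_graph x) \<and>
           SAP A' \<and> rank A' = rank A)"
  unfolding perturbable_to_def
proof (intro allI impI)
  fix \<epsilon> :: real assume e: "\<epsilon> > 0"
  have symA: "sym_mat A" using A by (simp add: mats_of_graph_def)
  \<comment> \<open>Parameters of norm below \<open>\<delta>\<close> keep \<open>mat 1 + K\<close>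
    invertible, so the congruence preserves the rank.\<close>
  obtain \<delta> where \<delta>: "\<delta> > 0" "\<And>K :: real^'n::{finite,linorder}^'n::{finite,linorder}. norm K < \<delta> \<Longrightarrow> invertible (mat 1 + K)"
    using invertible_near_identity by blast
  define dir where "dir = (\<lambda>(k, l). (unit_mat k l :: real^'n::{finite,linorder}^'n::{finite,linorder}, 0 :: real^'n::{finite,linorder}^'n::{finite,linorder}))"
  define col where "col = (\<lambda>(k, l) (B :: real^'n::{finite,linorder}^'n::{finite,linorder}). B ** unit_mat k l + unit_mat l k ** B)"
  define \<Phi> where "\<Phi> w = transpose (mat 1 + fst w) ** (A + snd w) ** (mat 1 + fst w)" for w
  have snd0: "snd u = 0" if "u \<in> span (dir ` col_ix (Psi_A G A))" for u
    using that by (rule snd_span_zero) (auto simp: dir_def)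
  have "\<exists>u\<in>span (dir ` col_ix (Psi_A G A)). norm u < min \<epsilon> \<delta> \<and> dist (\<Phi> u) A < min \<epsilon> \<delta> \<and>
      \<Phi> u \<in> mats_of_graph (G \<union> supp_graph x) \<and>
      (\<forall>X. sym_mat X \<and> hadamard (\<Phi> u) X = 0 \<and> hadamard (mat 1) X = 0 \<and>
           (\<forall>j\<in>col_ix (Psi_A G A). X \<bullet> col j (\<Phi> u) = 0) \<longrightarrow> X = 0)"
  proof (rule perturb_pattern[OF A _ _ _ _ _ _ _ _ _ _ x])
    show "min \<epsilon> \<delta> > 0" using e \<delta> by simp
    show "row_ix (Psi_A G A) = Ebar G" "finite (col_ix (Psi_A G A))"
      by (simp_all add: Psi_A_def)
    have "((\<lambda>K :: real^'n::{finite,linorder}^'n::{finite,linorder}. mat 1 + K) has_derivative (\<lambda>K. 0 + K)) (at 0)"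
      by (intro has_derivative_add has_derivative_const has_derivative_ident)
    from congruence_derivative[OF this]
    show "(\<Phi> has_derivative (\<lambda>w. A ** (0 + fst w) + snd w + transpose (0 + fst w) ** A)) (at 0)"
      unfolding \<Phi>_def[abs_def] by simp
    show "continuous_on UNIV \<Phi>"
      unfolding \<Phi>_def[abs_def] by (intro continuous_on_congruence continuous_intros)
    show "\<Phi> 0 = A" by (simp add: \<Phi>_def)
    show "sym_mat (\<Phi> u)" if "u \<in> span (dir ` col_ix (Psi_A G A))" for u
      using snd0[OF that] by (simp add: \<Phi>_def sym_mat_congruence symA)
    show "entry (Psi_A G A) p j = vec_coord (A ** (0 + fst (dir j)) + snd (dir j) + transpose (0 + fst (dir j)) ** A) p" for j p
      by (cases j) (simp add: dir_def Psi_A_def transpose_unit_mat)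
    show "entry (Psi_A G A) p j = vec_coord (col j A) p" for j p
      by (cases j) (simp add: col_def Psi_A_def)
    show "isCont (col j) A" for j
      by (cases j) (auto simp: col_def intro!: continuous_intros matrix_mult.continuous)
    show "sym_mat (col j B)" if "sym_mat B" for j B
      using sym_mat_plus_transpose[OF that, of "unit_mat (fst j) (snd j)"]
      by (cases j) (simp add: col_def transpose_unit_mat)
  qed
  then obtain u where u: "u \<in> span (dir ` col_ix (Psi_A G A))" "norm u < \<delta>" "dist (\<Phi> u) A < \<epsilon>"
      "\<Phi> u \<in> mats_of_graph (G \<union> supp_graph x)"
      and strong: "\<And>X. sym_mat X \<Longrightarrow> hadamard (\<Phi> u) X = 0 \<Longrightarrow> hadamard (mat 1) X = 0 \<Longrightarrow>
           (\<And>j. j \<in> col_ix (Psi_A G A) \<Longrightarrow> X \<bullet> col j (\<Phi> u) = 0) \<Longrightarrow> X = 0"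
    unfolding min_less_iff_conj by blast
  have sym\<Phi>: "sym_mat (\<Phi> u)" using u(4) by (simp add: mats_of_graph_def)
  have "SAP (\<Phi> u)"
    unfolding SAP_def
  proof (intro allI impI; elim conjE)
    fix X assume X: "sym_mat X" "hadamard (\<Phi> u) X = 0" "hadamard (mat 1) X = 0" "\<Phi> u ** X = 0"
    show "X = 0"
    proof (rule strong[OF X(1-3)])
      fix j
      show "X \<bullet> col j (\<Phi> u) = 0"
        using inner_sym_variation[OF X(1) sym\<Phi>, of "unit_mat (fst j) (snd j)"] X(4)
        by (cases j) (simp add: col_def transpose_unit_mat)
    qed
  qed
  moreover have "rank (\<Phi> u) = rank A"
  proof -
    have "norm (fst u) < \<delta>" using u(2) norm_fst_le[of "fst u" "snd u"] by simp
    then show ?thesis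
      using snd0[OF u(1)] by (simp add: \<Phi>_def rank_congruence \<delta>(2))
  qed
  ultimately show "\<exists>A'. dist A' A < \<epsilon> \<and> A' \<in> mats_of_graph (G \<union> supp_graph x) \<and>
      SAP A' \<and> rank A' = rank A"
    using u by blast
qed

lemma perturbable_SMP:
  fixes G :: "'n::{finite,linorder} set set"
    and A :: "real^'n::{finite,linorder}^'n::{finite,linorder}"
  assumes A: "A \<in> mats_of_graph G"
    and x: "x \<in> column_space (Psi_M G A)" "rows_independent (Psi_M G A) (Ebar G - supp x)"
  shows "perturbable_to A (\<lambda>A'. A' \<in> mats_of_graph (G \<union> supp_graph x) \<and>
           SMP A' \<and> ordered_mult_list A' = ordered_mult_list A)"
  unfolding perturbable_to_def
proof (intro allI impI)
  fix \<epsilon> :: real assume e: "\<epsilon> > 0"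
  have symA: "sym_mat A" using A by (simp add: mats_of_graph_def)
  obtain \<delta> where \<delta>: "\<delta> > 0" "\<And>D f. norm D < \<delta> \<Longrightarrow> (\<And>c v. A *v v = c *\<^sub>R v \<Longrightarrow> D *v v = f c *\<^sub>R v) \<Longrightarrow>
      strict_mono_on (eigvals A) (\<lambda>c. c + f c)"
    using strict_mono_on_perturbed_eigvals[OF symA] by blast
  \<comment> \<open>For the power columns the direction adds the fixed matrix
    \<open>mat_pow A k\<close>, whereas \<open>col\<close> takes the power of the varying
    \<open>B\<close>. They agree at \<open>A\<close>; the second form is the one tested by the
    traces in \<open>SMP\<close>.\<close>
  define dir where "dir = case_sum (\<lambda>(k, l). (skew_mat k l :: real^'n::{finite,linorder}^'n::{finite,linorder}, 0)) (\<lambda>k. (0, mat_pow A k))"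
  define col where "col = case_sum (\<lambda>(k, l) (B :: real^'n::{finite,linorder}^'n::{finite,linorder}). B ** skew_mat k l + skew_mat l k ** B)
      (\<lambda>k B. mat_pow B k)"
  define \<Phi> where "\<Phi> w = transpose (cayley (fst w)) ** (A + snd w) ** cayley (fst w)" for w
  \<comment> \<open>Symmetric matrices acting as a scalar on every eigenspace of \<open>A\<close>.
    They form a subspace containing all powers of \<open>A\<close>, hence every added matrix
    \<open>snd u\<close>; the scalars are the eigenvalue shifts.\<close>
  define V where "V = {D. sym_mat D \<and> (\<exists>f. \<forall>c v. A *v v = c *\<^sub>R v \<longrightarrow> D *v v = f c *\<^sub>R v)}"
  have "subspace V"
  proof (rule subspaceI)
    show "0 \<in> V" by (auto simp: V_def sym_mat_def intro!: exI[of _ "\<lambda>_. 0"])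
    fix D E assume "D \<in> V" "E \<in> V"
    then obtain f g where D: "sym_mat D" "\<And>c v. A *v v = c *\<^sub>R v \<Longrightarrow> D *v v = f c *\<^sub>R v"
        and E: "sym_mat E" "\<And>c v. A *v v = c *\<^sub>R v \<Longrightarrow> E *v v = g c *\<^sub>R v"
      by (auto simp: V_def)
    have "(D + E) *v v = (f c + g c) *\<^sub>R v" if "A *v v = c *\<^sub>R v" for c v
      by (simp add: D(2)[OF that] E(2)[OF that] matrix_vector_mult_add_rdistrib scaleR_left_distrib)
    then show "D + E \<in> V"
      using sym_mat_add[OF D(1) E(1)] by (auto simp: V_def intro!: exI[of _ "\<lambda>c. f c + g c"])
  next
    fix r D assume "D \<in> V"
    then obtain f where D: "sym_mat D" "\<And>c v. A *v v = c *\<^sub>R v \<Longrightarrow> D *v v = f c *\<^sub>R v"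
      by (auto simp: V_def)
    have "(r *\<^sub>R D) *v v = (r * f c) *\<^sub>R v" if "A *v v = c *\<^sub>R v" for c v
      using D(2)[OF that] by (simp flip: scaleR_matrix_vector_assoc)
    moreover have "sym_mat (r *\<^sub>R D)"
      using D(1) by (simp add: sym_mat_def transpose_scalar)
    ultimately show "r *\<^sub>R D \<in> V"
      by (auto simp: V_def intro!: exI[of _ "\<lambda>c. r * f c"])
  qed
  then have subV: "subspace {w :: (real^'n::{finite,linorder}^'n::{finite,linorder}) \<times> _. snd w \<in> V}"
    by (auto simp: subspace_def)
  have powV: "mat_pow A k \<in> V" for k
    using sym_mat_pow[OF symA] mat_pow_eigenvector by (auto simp: V_def intro!: exI[of _ "\<lambda>c. c ^ k"])
  have sndV: "snd u \<in> V" if "u \<in> span (dir ` col_ix (Psi_M G A))" for u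
  proof -
    have "dir ` col_ix (Psi_M G A) \<subseteq> {w. snd w \<in> V}"
      using powV subspace_0[OF \<open>subspace V\<close>] by (auto simp: dir_def Psi_M_def)
    then show ?thesis using span_minimal[OF _ subV] that by blast
  qed
  have "\<exists>u\<in>span (dir ` col_ix (Psi_M G A)). norm u < min \<epsilon> \<delta> \<and> dist (\<Phi> u) A < min \<epsilon> \<delta> \<and>
      \<Phi> u \<in> mats_of_graph (G \<union> supp_graph x) \<and>
      (\<forall>X. sym_mat X \<and> hadamard (\<Phi> u) X = 0 \<and> hadamard (mat 1) X = 0 \<and>
           (\<forall>j\<in>col_ix (Psi_M G A). X \<bullet> col j (\<Phi> u) = 0) \<longrightarrow> X = 0)"
  proof (rule perturb_pattern[OF A _ _ _ _ _ _ _ _ _ _ x])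
    show "min \<epsilon> \<delta> > 0" using e \<delta> by simp
    show "row_ix (Psi_M G A) = Ebar G" "finite (col_ix (Psi_M G A))"
      by (simp_all add: Psi_M_def Psi_S_def)
    show "(\<Phi> has_derivative (\<lambda>w. A ** ((1 / 2) *\<^sub>R (fst w - transpose (fst w))) + snd w +
        transpose ((1 / 2) *\<^sub>R (fst w - transpose (fst w))) ** A)) (at 0)"
      unfolding \<Phi>_def[abs_def] by (rule congruence_derivative[OF cayley_derivative cayley_0])
    show "continuous_on UNIV \<Phi>"
      unfolding \<Phi>_def[abs_def] by (rule continuous_on_congruence[OF continuous_on_cayley])
    show "\<Phi> 0 = A" by (simp add: \<Phi>_def)
    show "sym_mat (\<Phi> u)" if "u \<in> span (dir ` col_ix (Psi_M G A))" for u
      using sndV[OF that] by (simp add: \<Phi>_def V_def sym_mat_congruence sym_mat_add symA)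
    have skew: "(1 / 2) *\<^sub>R (skew_mat k l - skew_mat l k) = (skew_mat k l :: real^'n::{finite,linorder}^'n::{finite,linorder})" for k l
      by (simp add: skew_mat_def vec_eq_iff)
    show "entry (Psi_M G A) p j = vec_coord (A ** ((1 / 2) *\<^sub>R (fst (dir j) - transpose (fst (dir j)))) +
        snd (dir j) + transpose ((1 / 2) *\<^sub>R (fst (dir j) - transpose (fst (dir j)))) ** A) p" for j p
      by (cases j) (auto simp: dir_def Psi_M_def Psi_S_def transpose_skew_mat skew split: prod.splits)
    show "entry (Psi_M G A) p j = vec_coord (col j A) p" for j p
      by (cases j) (auto simp: col_def Psi_M_def Psi_S_def)
    show "isCont (col j) A" for j
      by (cases j) (auto simp: col_def intro!: continuous_intros matrix_mult.continuous isCont_mat_pow)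
    show "sym_mat (col j B)" if "sym_mat B" for j B
      using sym_mat_plus_transpose[OF that, of "skew_mat (fst (projl j)) (snd (projl j))"] sym_mat_pow[OF that]
      by (cases j) (auto simp: col_def transpose_skew_mat split: prod.splits)
  qed
  then obtain u where u: "u \<in> span (dir ` col_ix (Psi_M G A))" "norm u < \<delta>" "dist (\<Phi> u) A < \<epsilon>"
      "\<Phi> u \<in> mats_of_graph (G \<union> supp_graph x)"
      and strong: "\<And>X. sym_mat X \<Longrightarrow> hadamard (\<Phi> u) X = 0 \<Longrightarrow> hadamard (mat 1) X = 0 \<Longrightarrow>
           (\<And>j. j \<in> col_ix (Psi_M G A) \<Longrightarrow> X \<bullet> col j (\<Phi> u) = 0) \<Longrightarrow> X = 0"
    unfolding min_less_iff_conj by blast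
  have sym\<Phi>: "sym_mat (\<Phi> u)" using u(4) by (simp add: mats_of_graph_def)
  have "SMP (\<Phi> u)"
    unfolding SMP_def
  proof (intro allI impI; elim conjE)
    fix X assume X: "sym_mat X" "hadamard (\<Phi> u) X = 0" "hadamard (mat 1) X = 0" "commutator (\<Phi> u) X = 0"
      and tr: "\<forall>i\<in>{2..CARD('n) - 1}. trace (mat_pow (\<Phi> u) i ** X) = 0"
    show "X = 0"
    proof (rule strong[OF X(1-3)])
      fix j assume j: "j \<in> col_ix (Psi_M G A)"
      show "X \<bullet> col j (\<Phi> u) = 0"
      proof (cases j)
        case (Inl a)
        then show ?thesis
          using inner_sym_variation[OF X(1) sym\<Phi>, of "skew_mat (fst a) (snd a)"]
            inner_skew_mat[OF X(1) sym\<Phi> X(4)]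
          by (cases a) (simp add: col_def transpose_skew_mat)
      next
        case (Inr k)
        \<comment> \<open>The exponents run below the number of distinct eigenvalues of
          \<open>A\<close>, which is at most the dimension. Exponents 0 and 1 follow from the
          vanishing entrywise products, the others from the trace conditions.\<close>
        then have k: "k < CARD('n)"
          using j card_eigvals_le[OF symA] by (auto simp: Psi_M_def)
        consider "k = 0" | "k = 1" | "k \<ge> 2" by linarith
        then show ?thesis
        proof cases
          case 1
          then show ?thesis using inner_hadamard[OF X(3)] by (simp add: Inr col_def)
        next
          case 2
          then show ?thesis using inner_hadamard[OF X(2)] by (simp add: Inr col_def)
        next
          case 3
          then have "k \<in> {2..CARD('n) - 1}" using k by auto
          then show ?thesis using tr by (simp add: Inr col_def inner_eq_trace[OF X(1)])
        qed
      qed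
    qed
  qed
  moreover have "ordered_mult_list (\<Phi> u) = ordered_mult_list A"
  proof -
    obtain f where f: "sym_mat (snd u)" "\<And>c v. A *v v = c *\<^sub>R v \<Longrightarrow> snd u *v v = f c *\<^sub>R v"
      using sndV[OF u(1)] by (auto simp: V_def)
    have "norm (snd u) < \<delta>" using u(2) norm_snd_le[of "snd u" "fst u"] by simp
    then have mono: "strict_mono_on (eigvals A) (\<lambda>c. c + f c)" by (rule \<delta>(2)) (rule f(2))
    show ?thesis
      unfolding \<Phi>_def by (rule ordered_mult_list_perturbed[OF symA f(1) orthogonal_cayley f(2) mono])
  qed
  ultimately show "\<exists>A'. dist A' A < \<epsilon> \<and> A' \<in> mats_of_graph (G \<union> supp_graph x) \<and>
      SMP A' \<and> ordered_mult_list A' = ordered_mult_list A"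
    using u by blast
qed

theorem lemma7p3:
  fixes G :: "'n::{finite,linorder} set set"
    and A :: "real^'n::{finite,linorder}^'n::{finite,linorder}"
    and x :: "real^('n \<times> 'n)"
  assumes "is_graph G" and "A \<in> mats_of_graph G"
  shows "(x \<in> column_space (Psi_S G A) \<and> rows_independent (Psi_S G A) (Ebar G - supp x) \<longrightarrow>
            perturbable_to A (\<lambda>A'. A' \<in> mats_of_graph (G \<union> supp_graph x) \<and>
                                   SSP A' \<and> spectrum A' = spectrum A))
       \<and> (x \<in> column_space (Psi_M G A) \<and> rows_independent (Psi_M G A) (Ebar G - supp x) \<longrightarrow>
            perturbable_to A (\<lambda>A'. A' \<in> mats_of_graph (G \<union> supp_graph x) \<and>
                                   SMP A' \<and> ordered_mult_list A' = ordered_mult_list A))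
       \<and> (x \<in> column_space (Psi_A G A) \<and> rows_independent (Psi_A G A) (Ebar G - supp x) \<longrightarrow>
            perturbable_to A (\<lambda>A'. A' \<in> mats_of_graph (G \<union> supp_graph x) \<and>
                                   SAP A' \<and> rank A' = rank A))"
  using perturbable_SSP[OF assms(2)] perturbable_SMP[OF assms(2)] perturbable_SAP[OF assms(2)] by blast

end
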